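(* Let $u$ be the solution of the parabolic problem $\partial_t u+\mathcal{L}u=f$ in $\Omega\times(0,T]$, $u(\cdot,0)=u^0$, $u=0$ on $\partial\Omega\times[0,T]$, and let the Green's function bounds (with constants $\kappa_0,\kappa_1,\kappa_1',\gamma$) stated in the context hold. Let $0=t_0<t_1<\dots<t_M=T$ be an arbitrary mesh and let $U^j\in H_0^1(\Omega)$ be the backward Euler approximations: $U^0=u^0$ and $$\delta_t U^j+\mathcal{L}U^j=f^j\quad\text{in }\Omega,\qquad j=1,\dots,M.$$ Set $\delta_tU^0:=f^0-\mathcal{L}U^0$ and $\delta_t^2U^j:=\dfrac{\delta_tU^j-\delta_tU^{j-1}}{\tau_j}$, $j=1,\dots,M$. Then $$\|u(T)-U^M\|_{\infty,\Omega}\le\sum_{j=1}^M\mathrm{e}^{-\gamma(T-t_j)}\min\left\{\eta_{\bar f}^j+\eta_{\min}^j,\ \eta_{\hat f}^j+\eta_{\delta^2U}^j\right\},$$ where $$\eta_{\bar f}^j:=\kappa_0\int_{I_j}\|f(s)-f^j\|_{\infty,\Omega}\,\mathrm{d}s,\qquad \eta_{\hat f}^j:=\kappa_0\int_{I_j}\|(f-\hat f)(s)\|_{\infty,\Omega}\,\mathrm{d}s,\qquad \eta_{\delta^2U}^j:=\frac{\kappa_0\tau_j^2}{2}\|\delta_t^2U^j\|_{\infty,\Omega},$$ $$\eta_{\min}^j:=\min\left\{\eta_{\delta U}^j,\eta_{\delta\mathcal{L}U}^j\right\},\qquad \eta_{\delta\mathcal{L}U}^j:=\frac{\kappa_0\tau_j^2}{2}\|\delta_t(\mathcal{L}U)^j\|_{\infty,\Omega},\qquad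 \eta_{\delta U}^j:=\rho_j\|\delta_tU^j\|_{\infty,\Omega},$$ $$\rho_j:=\kappa_1\left[\tau_j-(T-t_j)\ln\left(1+\frac{\tau_j}{T-t_j}\right)\right]+\kappa_1'\frac{\tau_j^2}{2}.$$
   Context: Setting. $\Omega\subset\mathbb{R}^n$ is a spatial domain with Lipschitz boundary, $T>0$, $\mathcal{L}$ is a second-order linear elliptic operator in $\Omega$ with adjoint $\mathcal{L}^*$, $f\colon[0,T]\to L_2(\Omega)$, and $\mathcal{K}w:=\partial_t w+\mathcal{L}w$. For functions $w$ on $\Omega\times[0,T]$ write $w(t):=w(\cdot,t)$. $\|\cdot\|_{p,\Omega}$, $p\in[1,\infty]$, is the norm of $L_p(\Omega)$, and $\langle\cdot,\cdot\rangle$ denotes both the duality pairing on $H^{-1}(\Omega)\times H_0^1(\Omega)$ and the $L_2(\Omega)$ scalar product. Green's function. For fixed $x\in\Omega$, $\mathcal{G}$ solves $\partial_t\mathcal{G}+\mathcal{L}^*\mathcal{G}=0$ in $\Omega\times\mathbb{R}^+$, $\mathcal{G}|_{\partial\Omega}=0$, $\mathcal{G}(0)=\delta_x$ (Dirac distribution at $x$). For all $w\in W^{1,1}([0,T],H_0^1(\Omega))$ and $t\in(0,T]$ one has $w(x,t)=\langle\mathcal{G}(t),w(0)\rangle+\int_0^t\langle\mathcal{G}(t-s),(\mathcal{K}w)(s)\rangle\,\mathrm{d}s$; the solution $u$ is assumed regular enough that this representation applies to $u$ minus a continuous function that is piecewise polynomial in time and built from the discrete approximations. Standing assumption. There are non-negative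 constants $\kappa_0,\kappa_1,\kappa_2,\kappa_1',\kappa_2',\gamma$ such that, with $\kappa_0'=0$, $\|\partial_t^p\mathcal{G}(t)\|_{1,\Omega}\le\left(\frac{\kappa_p}{t^p}+\kappa_p'\right)\mathrm{e}^{-\gamma t}$ for all $x\in\bar\Omega$, $t\in[0,T]$, $p=0,1,2$. Mesh notation. $I_j:=(t_{j-1},t_j)$, $\tau_j:=t_j-t_{j-1}$; $f^j:=f(t_j)$; for $j\ge1$, $\delta_t v^j:=(v^j-v^{j-1})/\tau_j$; $(\mathcal{L}U)^j:=\mathcal{L}U^j$. $\hat f$ is the piecewise linear interpolant in time of $f$ on the mesh: $\hat f(s)=f^j-(t_j-s)\,\delta_tf^j$ for $s\in[t_{j-1},t_j]$. In the definition of $\rho_j$, for $j=M$ (where $T-t_M=0$) the product $(T-t_j)\ln(1+\tau_j/(T-t_j))$ is read as its limit $0$. *)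

theory Defs
  imports "HOL-Analysis.Analysis" "HOL-Probability.Essential_Supremum"
begin

text \<open>Functions on a domain \<open>\<Omega>\<close> are total functions on \<open>real ^ 'n\<close>. Their values outside \<open>\<Omega>\<close> never
  matter, since everything below is taken with respect to \<open>lebesgue_on \<Omega>\<close>. Functions that agree
  almost everywhere in \<open>\<Omega>\<close> are not identified.\<close>

subsection \<open>Domains\<close>

text \<open>Near each boundary point, \<open>\<Omega>\<close> is the part of a ball above the graph of a Lipschitz function
  \<open>h\<close> over the hyperplane orthogonal to the unit vector \<open>e\<close>.\<close>

definition lipschitz_boundary :: "(real ^ 'n) set \<Rightarrow> bool" where
  "lipschitz_boundary \<Omega> \<longleftrightarrow>
     (\<forall>z\<in>frontier \<Omega>. \<exists>e r C h. norm e = 1 \<and> 0 < r \<and> C-lipschitz_on UNIV h \<and>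
        \<Omega> \<inter> ball z r = {x \<in> ball z r. h (x - (x \<bullet> e) *\<^sub>R e) < x \<bullet> e})"

definition lipschitz_domain :: "(real ^ 'n) set \<Rightarrow> bool" where
  "lipschitz_domain \<Omega> \<longleftrightarrow> open \<Omega> \<and> connected \<Omega> \<and> \<Omega> \<noteq> {} \<and> lipschitz_boundary \<Omega>"

subsection \<open>Lebesgue and Sobolev spaces\<close>

definition L2 :: "(real ^ 'n) set \<Rightarrow> (real ^ 'n \<Rightarrow> 'b::euclidean_space) set" where
  "L2 \<Omega> = {w \<in> borel_measurable (lebesgue_on \<Omega>). integrable (lebesgue_on \<Omega>) (\<lambda>x. (norm (w x))\<^sup>2)}"

definition ip :: "(real ^ 'n) set \<Rightarrow> (real ^ 'n \<Rightarrow> real) \<Rightarrow> (real ^ 'n \<Rightarrow> real) \<Rightarrow> real" where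
  "ip \<Omega> v w = (\<integral>x. v x * w x \<partial>lebesgue_on \<Omega>)"

definition Linf_norm :: "(real ^ 'n) set \<Rightarrow> (real ^ 'n \<Rightarrow> real) \<Rightarrow> ennreal" where
  "Linf_norm \<Omega> w = esssup (lebesgue_on \<Omega>) (\<lambda>x. ennreal \<bar>w x\<bar>)"

definition L1_norm :: "(real ^ 'n) set \<Rightarrow> (real ^ 'n \<Rightarrow> real) \<Rightarrow> ennreal" where
  "L1_norm \<Omega> w = (\<integral>\<^sup>+x. ennreal \<bar>w x\<bar> \<partial>lebesgue_on \<Omega>)"

primrec Ck :: "nat \<Rightarrow> (real ^ 'n \<Rightarrow> real) \<Rightarrow> bool" where
  "Ck 0 \<phi> \<longleftrightarrow> continuous_on UNIV \<phi>"
| "Ck (Suc k) \<phi> \<longleftrightarrow> (\<exists>\<phi>'. (\<forall>x. (\<phi> has_derivative \<phi>' x) (at x)) \<and> (\<forall>v. Ck k (\<lambda>x. \<phi>' x v)))"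

definition test_fun :: "(real ^ 'n) set \<Rightarrow> (real ^ 'n \<Rightarrow> real) set" where
  "test_fun \<Omega> = {\<phi>. (\<forall>k. Ck k \<phi>) \<and> compact (closure {x. \<phi> x \<noteq> 0}) \<and> closure {x. \<phi> x \<noteq> 0} \<subseteq> \<Omega>}"

definition weak_gradient ::
    "(real ^ 'n) set \<Rightarrow> (real ^ 'n \<Rightarrow> real) \<Rightarrow> (real ^ 'n \<Rightarrow> real ^ 'n) \<Rightarrow> bool" where
  "weak_gradient \<Omega> w g \<longleftrightarrow> g \<in> L2 \<Omega> \<and>
     (\<forall>\<phi>\<in>test_fun \<Omega>. \<forall>i. ip \<Omega> w (\<lambda>x. frechet_derivative \<phi> (at x) (axis i 1)) = - ip \<Omega> (\<lambda>x. g x $ i) \<phi>)"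

definition H1 :: "(real ^ 'n) set \<Rightarrow> (real ^ 'n \<Rightarrow> real) set" where
  "H1 \<Omega> = {w \<in> L2 \<Omega>. \<exists>g. weak_gradient \<Omega> w g}"

definition grad :: "(real ^ 'n) set \<Rightarrow> (real ^ 'n \<Rightarrow> real) \<Rightarrow> real ^ 'n \<Rightarrow> real ^ 'n" where
  "grad \<Omega> w = (SOME g. weak_gradient \<Omega> w g)"

definition H1_norm :: "(real ^ 'n) set \<Rightarrow> (real ^ 'n \<Rightarrow> real) \<Rightarrow> real" where
  "H1_norm \<Omega> w = sqrt (\<integral>x. (w x)\<^sup>2 + (norm (grad \<Omega> w x))\<^sup>2 \<partial>lebesgue_on \<Omega>)"

definition H10 :: "(real ^ 'n) set \<Rightarrow> (real ^ 'n \<Rightarrow> real) set" where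
  "H10 \<Omega> = {w \<in> H1 \<Omega>. \<exists>\<phi>. (\<forall>n. \<phi> n \<in> test_fun \<Omega>) \<and> (\<lambda>n. H1_norm \<Omega> (\<lambda>x. w x - \<phi> n x)) \<longlonglongrightarrow> 0}"

subsection \<open>Functionals on \<open>H10\<close> and their norms\<close>

text \<open>Elements of \<open>H\<^sup>-\<^sup>1\<close> are functionals on \<open>H10 \<Omega>\<close>; values at other arguments are irrelevant. An
  \<open>L\<^sub>p\<close> norm of a functional is the norm of the locally integrable function representing it, and
  \<open>\<infinity>\<close> if there is none (\<open>Inf {} = \<infinity>\<close>).\<close>

type_synonym 'n fnl = "(real ^ 'n \<Rightarrow> real) \<Rightarrow> real"

definition represents :: "(real ^ 'n) set \<Rightarrow> (real ^ 'n \<Rightarrow> real) \<Rightarrow> 'n fnl \<Rightarrow> bool" where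
  "represents \<Omega> g F \<longleftrightarrow> g \<in> borel_measurable (lebesgue_on \<Omega>) \<and>
     (\<forall>\<phi>\<in>test_fun \<Omega>. integrable (lebesgue_on \<Omega>) (\<lambda>x. g x * \<phi> x)) \<and>
     (\<forall>\<phi>\<in>H10 \<Omega>. integrable (lebesgue_on \<Omega>) (\<lambda>x. g x * \<phi> x) \<longrightarrow> F \<phi> = ip \<Omega> g \<phi>)"

definition Linf_fnorm :: "(real ^ 'n) set \<Rightarrow> 'n fnl \<Rightarrow> ennreal" where
  "Linf_fnorm \<Omega> F = (INF g\<in>{g. represents \<Omega> g F}. Linf_norm \<Omega> g)"

definition L1_fnorm :: "(real ^ 'n) set \<Rightarrow> 'n fnl \<Rightarrow> ennreal" where
  "L1_fnorm \<Omega> F = (INF g\<in>{g. represents \<Omega> g F}. L1_norm \<Omega> g)"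

subsection \<open>Elliptic operators\<close>

text \<open>The operator \<open>w \<mapsto> - div (A \<nabla>w + w d) + b \<bullet> \<nabla>w + c w\<close> with bounded measurable
  coefficients, as a map from \<open>H10 \<Omega>\<close> to functionals. The class is closed under taking adjoints;
  the adjoint of \<open>L\<close> is \<open>\<lambda>v \<phi>. L \<phi> v\<close>.\<close>

definition elliptic_operator :: "(real ^ 'n) set \<Rightarrow> ((real ^ 'n \<Rightarrow> real) \<Rightarrow> 'n fnl) \<Rightarrow> bool" where
  "elliptic_operator \<Omega> L \<longleftrightarrow>
     (\<exists>(A :: real ^ 'n \<Rightarrow> real ^ 'n ^ 'n) (b :: real ^ 'n \<Rightarrow> real ^ 'n) (d :: real ^ 'n \<Rightarrow> real ^ 'n)
        (c :: real ^ 'n \<Rightarrow> real) C \<alpha>.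
        A \<in> borel_measurable (lebesgue_on \<Omega>) \<and> b \<in> borel_measurable (lebesgue_on \<Omega>) \<and>
        d \<in> borel_measurable (lebesgue_on \<Omega>) \<and> c \<in> borel_measurable (lebesgue_on \<Omega>) \<and>
        (AE x in lebesgue_on \<Omega>. norm (A x) \<le> C \<and> norm (b x) \<le> C \<and> norm (d x) \<le> C \<and> \<bar>c x\<bar> \<le> C) \<and>
        0 < \<alpha> \<and> (AE x in lebesgue_on \<Omega>. \<forall>\<xi>. \<alpha> * (norm \<xi>)\<^sup>2 \<le> \<xi> \<bullet> (A x *v \<xi>)) \<and>
        (\<forall>w\<in>H10 \<Omega>. \<forall>\<phi>\<in>H10 \<Omega>. L w \<phi> =
           (\<integral>x. (A x *v grad \<Omega> w x + w x *\<^sub>R d x) \<bullet> grad \<Omega> \<phi> x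
                + (b x \<bullet> grad \<Omega> w x) * \<phi> x + c x * w x * \<phi> x \<partial>lebesgue_on \<Omega>)))"

subsection \<open>Time-dependent functions\<close>

text \<open>Bochner integrability of \<open>v\<close> over \<open>[0,T]\<close> with values in \<open>H10 \<Omega>\<close>: strong measurability plus
  integrability of the norm. The measure is \<open>lebesgue\<close>, not \<open>lborel\<close>: completeness is needed for almost
  everywhere limits of measurable functions to be measurable.\<close>

definition bochner_H10 :: "real \<Rightarrow> (real ^ 'n) set \<Rightarrow> (real \<Rightarrow> real ^ 'n \<Rightarrow> real) \<Rightarrow> bool" where
  "bochner_H10 T \<Omega> v \<longleftrightarrow> (\<forall>s\<in>{0..T}. v s \<in> H10 \<Omega>) \<and>
     (\<exists>\<psi>. (\<forall>n. simple_function lebesgue (\<psi> n) \<and> range (\<psi> n) \<subseteq> H10 \<Omega>) \<and>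
          (AE s in lebesgue. s \<in> {0..T} \<longrightarrow> (\<lambda>n. H1_norm \<Omega> (\<lambda>x. \<psi> n s x - v s x)) \<longlonglongrightarrow> 0)) \<and>
     set_integrable lebesgue {0..T} (\<lambda>s. H1_norm \<Omega> (v s))"

text \<open>\<open>w\<close> is (the continuous representative of) an element of \<open>W\<^sup>1\<^sup>,\<^sup>1([0,T], H10 \<Omega>)\<close> with time
  derivative \<open>w'\<close>. The identity \<open>w t = w 0 + \<integral>\<^sub>0\<^sup>t w' s ds\<close> is tested against \<open>H10 \<Omega>\<close>, which
  separates points.\<close>

definition W11_H10 ::
    "real \<Rightarrow> (real ^ 'n) set \<Rightarrow> (real \<Rightarrow> real ^ 'n \<Rightarrow> real) \<Rightarrow> (real \<Rightarrow> real ^ 'n \<Rightarrow> real) \<Rightarrow> bool" where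
  "W11_H10 T \<Omega> w w' \<longleftrightarrow> (\<forall>t\<in>{0..T}. w t \<in> H10 \<Omega>) \<and> bochner_H10 T \<Omega> w' \<and>
     (\<forall>t\<in>{0..T}. \<forall>\<phi>\<in>H10 \<Omega>. ip \<Omega> (w t) \<phi> = ip \<Omega> (w 0) \<phi> + (LINT s:{0..t}|lebesgue. ip \<Omega> (w' s) \<phi>))"

definition parabolic_op ::
    "(real ^ 'n) set \<Rightarrow> ((real ^ 'n \<Rightarrow> real) \<Rightarrow> 'n fnl) \<Rightarrow> (real \<Rightarrow> real ^ 'n \<Rightarrow> real) \<Rightarrow>
     (real \<Rightarrow> real ^ 'n \<Rightarrow> real) \<Rightarrow> real \<Rightarrow> 'n fnl" where
  "parabolic_op \<Omega> L w w' s = (\<lambda>\<phi>. ip \<Omega> (w' s) \<phi> + L (w s) \<phi>)"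

definition parabolic_solution ::
    "real \<Rightarrow> (real ^ 'n) set \<Rightarrow> ((real ^ 'n \<Rightarrow> real) \<Rightarrow> 'n fnl) \<Rightarrow> (real \<Rightarrow> real ^ 'n \<Rightarrow> real) \<Rightarrow>
     (real ^ 'n \<Rightarrow> real) \<Rightarrow> (real \<Rightarrow> real ^ 'n \<Rightarrow> real) \<Rightarrow> bool" where
  "parabolic_solution T \<Omega> L f u0 u \<longleftrightarrow>
     (\<exists>u'. W11_H10 T \<Omega> u u' \<and>
        (AE s in lebesgue. s \<in> {0<..T} \<longrightarrow> (\<forall>\<phi>\<in>H10 \<Omega>. parabolic_op \<Omega> L u u' s \<phi> = ip \<Omega> (f s) \<phi>))) \<and>
     (AE x in lebesgue_on \<Omega>. u 0 x = u0 x)"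

subsection \<open>Green's function\<close>

text \<open>\<open>G x t\<close> is the Green's function with pole \<open>x\<close> at time \<open>t > 0\<close>. As elements of \<open>H10 \<Omega>\<close> have no
  canonical point values, the representation formula is required for almost every \<open>x\<close>.\<close>

definition greens_function ::
    "real \<Rightarrow> (real ^ 'n) set \<Rightarrow> ((real ^ 'n \<Rightarrow> real) \<Rightarrow> 'n fnl) \<Rightarrow>
     (real ^ 'n \<Rightarrow> real \<Rightarrow> real ^ 'n \<Rightarrow> real) \<Rightarrow> bool" where
  "greens_function T \<Omega> L G \<longleftrightarrow>
     (\<forall>x\<in>\<Omega>.
        (\<forall>t>0. G x t \<in> H10 \<Omega>) \<and>
        (\<forall>t>0. \<forall>\<phi>\<in>H10 \<Omega>. ((\<lambda>s. ip \<Omega> (G x s) \<phi>) has_real_derivative - L \<phi> (G x t)) (at t)) \<and>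
        (\<forall>\<phi>\<in>test_fun \<Omega>. ((\<lambda>t. ip \<Omega> (G x t) \<phi>) \<longlongrightarrow> \<phi> x) (at_right 0))) \<and>
     (\<forall>w w'. W11_H10 T \<Omega> w w' \<longrightarrow> (\<forall>t\<in>{0<..T}. AE x in lebesgue_on \<Omega>.
        set_integrable lebesgue {0..t} (\<lambda>s. parabolic_op \<Omega> L w w' s (G x (t - s))) \<and>
        w t x = ip \<Omega> (G x t) (w 0)
              + (LINT s:{0..t}|lebesgue. parabolic_op \<Omega> L w w' s (G x (t - s)))))"

text \<open>The time derivative of \<open>G x\<close> is the functional \<open>\<phi> \<mapsto> d/dt \<langle>G x t, \<phi>\<rangle>\<close>.\<close>

definition greens_bounds ::
    "real \<Rightarrow> (real ^ 'n) set \<Rightarrow> (real ^ 'n \<Rightarrow> real \<Rightarrow> real ^ 'n \<Rightarrow> real) \<Rightarrow>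
     real \<Rightarrow> real \<Rightarrow> real \<Rightarrow> real \<Rightarrow> bool" where
  "greens_bounds T \<Omega> G \<kappa>0 \<kappa>1 \<kappa>1' \<gamma> \<longleftrightarrow>
     (\<forall>x\<in>\<Omega>. \<forall>t\<in>{0<..T}.
        L1_norm \<Omega> (G x t) \<le> ennreal (\<kappa>0 * exp (- \<gamma> * t)) \<and>
        L1_fnorm \<Omega> (\<lambda>\<phi>. deriv (\<lambda>s. ip \<Omega> (G x s) \<phi>) t) \<le> ennreal ((\<kappa>1 / t + \<kappa>1') * exp (- \<gamma> * t)))"

subsection \<open>Time mesh and backward Euler approximations\<close>

definition mesh :: "real \<Rightarrow> nat \<Rightarrow> (nat \<Rightarrow> real) \<Rightarrow> bool" where
  "mesh T M t \<longleftrightarrow> t 0 = 0 \<and> t M = T \<and> (\<forall>j\<in>{1..M}. t (j - 1) < t j)"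

definition tstep :: "(nat \<Rightarrow> real) \<Rightarrow> nat \<Rightarrow> real" where
  "tstep t j = t j - t (j - 1)"

text \<open>Difference quotients of sequences of functions or, with \<open>'x\<close> a function type, of functionals.\<close>

definition dq :: "(nat \<Rightarrow> real) \<Rightarrow> (nat \<Rightarrow> 'x \<Rightarrow> real) \<Rightarrow> nat \<Rightarrow> 'x \<Rightarrow> real" where
  "dq t v j = (\<lambda>y. (v j y - v (j - 1) y) / tstep t j)"

definition backward_euler ::
    "(real ^ 'n) set \<Rightarrow> ((real ^ 'n \<Rightarrow> real) \<Rightarrow> 'n fnl) \<Rightarrow> (real \<Rightarrow> real ^ 'n \<Rightarrow> real) \<Rightarrow>
     (real ^ 'n \<Rightarrow> real) \<Rightarrow> nat \<Rightarrow> (nat \<Rightarrow> real) \<Rightarrow> (nat \<Rightarrow> real ^ 'n \<Rightarrow> real) \<Rightarrow> bool" where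
  "backward_euler \<Omega> L f u0 M t U \<longleftrightarrow>
     (\<forall>j\<le>M. U j \<in> H10 \<Omega>) \<and> (AE x in lebesgue_on \<Omega>. U 0 x = u0 x) \<and>
     (\<forall>j\<in>{1..M}. \<forall>\<phi>\<in>H10 \<Omega>. ip \<Omega> (dq t U j) \<phi> + L (U j) \<phi> = ip \<Omega> (f (t j)) \<phi>)"

text \<open>\<open>\<delta>\<^sub>t U\<^sup>j\<close> as a functional for all \<open>j \<ge> 0\<close>; for \<open>j = 0\<close> it is \<open>f\<^sup>0 - L U\<^sup>0\<close>, which need not be a
  function.\<close>

definition dtU ::
    "(real ^ 'n) set \<Rightarrow> ((real ^ 'n \<Rightarrow> real) \<Rightarrow> 'n fnl) \<Rightarrow> (real \<Rightarrow> real ^ 'n \<Rightarrow> real) \<Rightarrow>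
     (nat \<Rightarrow> real) \<Rightarrow> (nat \<Rightarrow> real ^ 'n \<Rightarrow> real) \<Rightarrow> nat \<Rightarrow> 'n fnl" where
  "dtU \<Omega> L f t U j = (\<lambda>\<phi>. if j = 0 then ip \<Omega> (f (t 0)) \<phi> - L (U 0) \<phi> else ip \<Omega> (dq t U j) \<phi>)"

text \<open>The piecewise linear interpolant of \<open>f\<close>, given on \<open>[t\<^sub>j\<^sub>-\<^sub>1, t\<^sub>j]\<close>.\<close>

definition fhat ::
    "(nat \<Rightarrow> real) \<Rightarrow> (real \<Rightarrow> real ^ 'n \<Rightarrow> real) \<Rightarrow> nat \<Rightarrow> real \<Rightarrow> real ^ 'n \<Rightarrow> real" where
  "fhat t f j s = (\<lambda>x. f (t j) x - (t j - s) * dq t (\<lambda>i. f (t i)) j x)"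

subsection \<open>Error estimators\<close>

definition eta_fbar ::
    "(real ^ 'n) set \<Rightarrow> real \<Rightarrow> (nat \<Rightarrow> real) \<Rightarrow> (real \<Rightarrow> real ^ 'n \<Rightarrow> real) \<Rightarrow> nat \<Rightarrow> ennreal" where
  "eta_fbar \<Omega> \<kappa>0 t f j =
     ennreal \<kappa>0 * (\<integral>\<^sup>+s\<in>{t (j - 1)<..<t j}. Linf_norm \<Omega> (\<lambda>x. f s x - f (t j) x) \<partial>lebesgue)"

definition eta_fhat ::
    "(real ^ 'n) set \<Rightarrow> real \<Rightarrow> (nat \<Rightarrow> real) \<Rightarrow> (real \<Rightarrow> real ^ 'n \<Rightarrow> real) \<Rightarrow> nat \<Rightarrow> ennreal" where
  "eta_fhat \<Omega> \<kappa>0 t f j =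
     ennreal \<kappa>0 * (\<integral>\<^sup>+s\<in>{t (j - 1)<..<t j}. Linf_norm \<Omega> (\<lambda>x. f s x - fhat t f j s x) \<partial>lebesgue)"

definition eta_d2U ::
    "(real ^ 'n) set \<Rightarrow> ((real ^ 'n \<Rightarrow> real) \<Rightarrow> 'n fnl) \<Rightarrow> real \<Rightarrow> (nat \<Rightarrow> real) \<Rightarrow>
     (real \<Rightarrow> real ^ 'n \<Rightarrow> real) \<Rightarrow> (nat \<Rightarrow> real ^ 'n \<Rightarrow> real) \<Rightarrow> nat \<Rightarrow> ennreal" where
  "eta_d2U \<Omega> L \<kappa>0 t f U j =
     ennreal (\<kappa>0 * (tstep t j)\<^sup>2 / 2) * Linf_fnorm \<Omega> (dq t (dtU \<Omega> L f t U) j)"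

definition eta_dLU ::
    "(real ^ 'n) set \<Rightarrow> ((real ^ 'n \<Rightarrow> real) \<Rightarrow> 'n fnl) \<Rightarrow> real \<Rightarrow> (nat \<Rightarrow> real) \<Rightarrow>
     (nat \<Rightarrow> real ^ 'n \<Rightarrow> real) \<Rightarrow> nat \<Rightarrow> ennreal" where
  "eta_dLU \<Omega> L \<kappa>0 t U j =
     ennreal (\<kappa>0 * (tstep t j)\<^sup>2 / 2) * Linf_fnorm \<Omega> (dq t (\<lambda>i. L (U i)) j)"

text \<open>For \<open>t j = T\<close> the logarithmic term vanishes, as \<open>0 * ln (1 + \<tau> / 0) = 0\<close> in HOL; this is its
  limit.\<close>

definition rho :: "real \<Rightarrow> real \<Rightarrow> real \<Rightarrow> (nat \<Rightarrow> real) \<Rightarrow> nat \<Rightarrow> real" where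
  "rho T \<kappa>1 \<kappa>1' t j =
     \<kappa>1 * (tstep t j - (T - t j) * ln (1 + tstep t j / (T - t j))) + \<kappa>1' * (tstep t j)\<^sup>2 / 2"

definition eta_dU ::
    "real \<Rightarrow> (real ^ 'n) set \<Rightarrow> real \<Rightarrow> real \<Rightarrow> (nat \<Rightarrow> real) \<Rightarrow> (nat \<Rightarrow> real ^ 'n \<Rightarrow> real) \<Rightarrow> nat \<Rightarrow> ennreal" where
  "eta_dU T \<Omega> \<kappa>1 \<kappa>1' t U j = ennreal (rho T \<kappa>1 \<kappa>1' t j) * Linf_norm \<Omega> (dq t U j)"

end

theory Submission
  imports Defs
begin

text \<open>Let \<open>V\<close> be the piecewise linear interpolant in time of the backward Euler approximations. For
  \<open>s\<close> in the \<open>k\<close>-th mesh interval, the backward Euler equation shows that the error \<open>u - V\<close> has the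
  residual \<open>f(s) - f(t\<^sub>k) + (t\<^sub>k - s) \<delta>\<^sub>t (L U)\<^sup>k\<close> with respect to the parabolic operator. Since the error
  vanishes at time 0, the Green's function represents its value at \<open>(x, T)\<close> as the integral over \<open>s\<close> of this residual, paired with \<open>G x (T - s)\<close> (lemma \<open>error_representation\<close>).

  On every mesh interval the pairing is estimated in three ways (lemma \<open>residual_integral_le\<close>), and the
  best of them may be chosen for each interval separately:

  \<^item> The last term is bounded by the maximum norm of \<open>\<delta>\<^sub>t (L U)\<close> and the \<open>L\<^sub>1\<close> norm of \<open>G\<close>. The
    weight \<open>t\<^sub>k - s\<close> integrates to \<open>\<tau>\<^sub>k\<^sup>2 / 2\<close>.

  \<^item> The operator is moved to the Green's function, \<open>\<langle>L w, G\<rangle> = - d/dt \<langle>G, w\<rangle>\<close>, and the \<open>L\<^sub>1\<close> bound on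
    the time derivative of \<open>G\<close> is used. The weight \<open>(t\<^sub>k - s) (\<kappa>1 / (T - s) + \<kappa>1')\<close> integrates to
    \<open>\<rho>\<^sub>k\<close> (lemma \<open>nn_integral_rho\<close>).

  \<^item> The discrete equation gives \<open>\<delta>\<^sub>t (L U) = \<delta>\<^sub>t f - \<delta>\<^sub>t\<^sup>2 U\<close>. The term with \<open>\<delta>\<^sub>t f\<close> turns
    \<open>f(t\<^sub>k)\<close> into the linear interpolant of \<open>f\<close>.

  The remaining work is to make these manipulations legitimate. Bounding a pairing by the \<open>L\<^sub>1\<close> norm
  of a functional uses that the functional is represented by at most one function, up to null sets; this
  is the fundamental lemma of the calculus of variations. The second estimate tests a functional with
  \<open>\<delta>\<^sub>t U\<close>, which lies in \<open>H10\<close> because \<open>H10\<close> is a linear space; this in turn rests on the uniqueness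
  of weak gradients and on integration by parts for test functions. Finally, the norms
  of \<open>f(s) - f(t\<^sub>k)\<close> need not be measurable in \<open>s\<close>, so that the integrals in the estimators are only lower
  integrals (lemma \<open>nn_integral_le_nonmeasurable\<close>).\<close>

section \<open>Test functions\<close>

lemma Ck_imp_continuous: "Ck k \<phi> \<Longrightarrow> continuous_on UNIV \<phi>"
  by (cases k) (auto intro: continuous_at_imp_continuous_on dest: has_derivative_continuous)

lemma Ck_SucD: "Ck (Suc k) \<phi> \<Longrightarrow> Ck k \<phi>"
proof (induction k arbitrary: \<phi>)
  case 0
  then show ?case using Ck_imp_continuous by fastforce
next
  case (Suc k)
  then obtain \<phi>' where "\<forall>x. (\<phi> has_derivative \<phi>' x) (at x)" "\<forall>v. Ck (Suc k) (\<lambda>x. \<phi>' x v)"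
    by auto
  then show ?case using Suc.IH by auto
qed

lemma Ck_const: "Ck k (\<lambda>x. c)"
proof (induction k arbitrary: c)
  case (Suc k)
  have "\<forall>x. ((\<lambda>x. c) has_derivative (\<lambda>v. 0)) (at x)" by simp
  with Suc show ?case by (auto intro!: exI[of _ "\<lambda>x v. 0"])
qed simp

lemma Ck_add: "Ck k \<phi> \<Longrightarrow> Ck k \<psi> \<Longrightarrow> Ck k (\<lambda>x. \<phi> x + \<psi> x)"
proof (induction k arbitrary: \<phi> \<psi>)
  case 0
  then show ?case by (auto intro: continuous_on_add)
next
  case (Suc k)
  from Suc.prems obtain \<phi>' \<psi>' where
    "\<forall>x. (\<phi> has_derivative \<phi>' x) (at x)" "\<forall>v. Ck k (\<lambda>x. \<phi>' x v)"
    "\<forall>x. (\<psi> has_derivative \<psi>' x) (at x)" "\<forall>v. Ck k (\<lambda>x. \<psi>' x v)"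
    by auto
  with Suc.IH show ?case
    by (auto intro!: exI[of _ "\<lambda>x v. \<phi>' x v + \<psi>' x v"] has_derivative_add)
qed

lemma Ck_mult: "Ck k \<phi> \<Longrightarrow> Ck k \<psi> \<Longrightarrow> Ck k (\<lambda>x. \<phi> x * \<psi> x)"
proof (induction k arbitrary: \<phi> \<psi>)
  case 0
  then show ?case by (auto intro: continuous_on_mult)
next
  case (Suc k)
  from Suc.prems obtain \<phi>' \<psi>' where d:
    "\<forall>x. (\<phi> has_derivative \<phi>' x) (at x)" "\<forall>v. Ck k (\<lambda>x. \<phi>' x v)"
    "\<forall>x. (\<psi> has_derivative \<psi>' x) (at x)" "\<forall>v. Ck k (\<lambda>x. \<psi>' x v)"
    by auto
  have "Ck k \<phi>" "Ck k \<psi>" using Suc.prems by (auto intro!: Ck_SucD simp del: Ck.simps)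
  with d Suc.IH show ?case
    by (auto intro!: exI[of _ "\<lambda>x v. \<phi> x * \<psi>' x v + \<phi>' x v * \<psi> x"] has_derivative_mult Ck_add)
qed

lemma Ck_prod: "finite I \<Longrightarrow> (\<And>i. i \<in> I \<Longrightarrow> Ck k (\<phi> i)) \<Longrightarrow> Ck k (\<lambda>x. \<Prod>i\<in>I. \<phi> i x)"
  by (induction rule: finite_induct) (auto intro: Ck_mult Ck_const)

text \<open>For \<open>p = 1\<close> this is the standard smooth function that is positive exactly on the positive reals.
  The factor \<open>poly p (1 / r)\<close> makes the family closed under differentiation, which gives smoothness
  of all its members at once by induction on the order of differentiability.\<close>

definition flat :: "real poly \<Rightarrow> real \<Rightarrow> real" where
  "flat p r = (if 0 < r then poly p (1 / r) * exp (- 1 / r) else 0)"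

lemma poly_times_exp_neg_tendsto_0: "((\<lambda>y::real. poly p y * exp (- y)) \<longlongrightarrow> 0) at_top"
proof -
  have "((\<lambda>y. \<Sum>i\<le>degree p. coeff p i * (y ^ i / exp y)) \<longlongrightarrow> (\<Sum>i\<le>degree p. coeff p i * 0)) at_top"
    by (intro tendsto_sum tendsto_mult tendsto_const tendsto_power_div_exp_0)
  also have "(\<lambda>y. \<Sum>i\<le>degree p. coeff p i * (y ^ i / exp y)) = (\<lambda>y. poly p y * exp (- y))"
    by (auto simp: poly_altdef exp_minus sum_distrib_right divide_inverse mult.assoc)
  finally show ?thesis by simp
qed

text \<open>With \<open>y = 1 / r\<close> one has \<open>dy/dr = - y\<^sup>2\<close>, which explains the polynomial in the derivative. At
  \<open>r = 0\<close> the exponential beats every power of \<open>y\<close>.\<close>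

lemma flat_has_derivative:
  "(flat p has_real_derivative flat ((p - pderiv p) * [:0, 0, 1:]) r) (at r)"
proof (cases r "0::real" rule: linorder_cases)
  case less
  have "((\<lambda>r. 0) has_real_derivative 0) (at r)" by simp
  moreover have "eventually (\<lambda>s. (0::real) = flat p s) (nhds r)"
    using eventually_nhds_in_open[of "{..<0}" r] less by (auto elim!: eventually_mono simp: flat_def)
  ultimately show ?thesis
    using less by (subst (asm) DERIV_cong_ev[OF refl _ refl]) (auto simp: flat_def)
next
  case greater
  have "((\<lambda>r. poly p (1 / r) * exp (- 1 / r)) has_real_derivative
          flat ((p - pderiv p) * [:0, 0, 1:]) r) (at r)"
    using greater
    by (auto intro!: derivative_eq_intros simp: flat_def field_simps power2_eq_square)
  moreover have "eventually (\<lambda>s. poly p (1 / s) * exp (- 1 / s) = flat p s) (nhds r)"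
    using eventually_nhds_in_open[of "{0<..}" r] greater by (auto elim!: eventually_mono simp: flat_def)
  ultimately show ?thesis
    by (subst (asm) DERIV_cong_ev[OF refl _ refl]) auto
next
  case equal
  have "((\<lambda>h. poly (pCons 0 p) (inverse h) * exp (- inverse h)) \<longlongrightarrow> 0) (at_right 0)"
    by (rule filterlim_compose[OF poly_times_exp_neg_tendsto_0 filterlim_inverse_at_top_right])
  moreover have "eventually (\<lambda>h. poly (pCons 0 p) (inverse h) * exp (- inverse h)
      = (flat p (0 + h) - flat p 0) / h) (at_right 0)"
    using eventually_at_right_less by eventually_elim (auto simp: flat_def field_simps)
  ultimately have "((\<lambda>h. (flat p (0 + h) - flat p 0) / h) \<longlongrightarrow> 0) (at_right 0)"
    by (rule Lim_transform_eventually)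
  moreover have "eventually (\<lambda>h. 0 = (flat p (0 + h) - flat p 0) / h) (at_left 0)"
    unfolding eventually_at_filter by (auto simp: flat_def)
  then have "((\<lambda>h. (flat p (0 + h) - flat p 0) / h) \<longlongrightarrow> 0) (at_left 0)"
    by (rule Lim_transform_eventually[OF tendsto_const])
  ultimately show ?thesis
    using equal by (auto simp: DERIV_def filterlim_split_at flat_def)
qed

lemma Ck_flat_affine: "Ck k (\<lambda>x. flat p (c + a * x $ i))"
proof (induction k arbitrary: p)
  case 0
  have "continuous_on UNIV (flat p)"
    by (meson DERIV_isCont continuous_at_imp_continuous_on flat_has_derivative)
  then have "continuous_on UNIV (flat p \<circ> (\<lambda>x::real^'a. c + a * x $ i))"
    by (intro continuous_on_compose continuous_intros) (auto intro: continuous_on_subset)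
  then show ?case by (simp add: o_def)
next
  case (Suc k)
  let ?q = "(p - pderiv p) * [:0, 0, 1:]"
  have "((\<lambda>x. flat p (c + a * x $ i)) has_derivative
          (\<lambda>v. flat ?q (c + a * x $ i) * (a * v $ i))) (at x)" for x :: "real^'a"
  proof -
    have "((\<lambda>x::real^'a. c + a * x $ i) has_derivative (\<lambda>v. a * v $ i)) (at x)"
      by (auto intro!: derivative_eq_intros bounded_linear_imp_has_derivative)
    moreover have "(flat p has_derivative (\<lambda>v. flat ?q (c + a * x $ i) * v)) (at (c + a * x $ i))"
      using flat_has_derivative[of p "c + a * x $ i"] by (simp add: has_field_derivative_def)
    ultimately show ?thesis
      by (rule has_derivative_compose)
  qed
  moreover have "Ck k (\<lambda>x. flat ?q (c + a * x $ i) * (a * v $ i))" for v :: "real^'a"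
    by (intro Ck_mult Suc Ck_const)
  ultimately show ?case
    unfolding Ck.simps by (intro exI[of _ "\<lambda>x v. flat ?q (c + a * x $ i) * (a * v $ i)"]) auto
qed

text \<open>The parameter \<open>n\<close> steepens the flanks without changing the support, which makes these functions
  smooth substitutes for the indicator function of \<open>box a b\<close>.\<close>

definition bump :: "real ^ 'n \<Rightarrow> real ^ 'n \<Rightarrow> real \<Rightarrow> real ^ 'n \<Rightarrow> real" where
  "bump a b n x = (\<Prod>i\<in>UNIV. flat 1 (n * (x $ i - a $ i)) * flat 1 (n * (b $ i - x $ i)))"

lemma flat_one_bounds: "0 \<le> flat 1 r" "flat 1 r \<le> 1" "0 < flat 1 r \<longleftrightarrow> 0 < r"
  by (auto simp: flat_def)

lemma bump_bounds: "0 \<le> bump a b n x" "bump a b n x \<le> 1"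
  unfolding bump_def
  by (auto intro!: prod_nonneg prod_le_1 mult_le_one simp: flat_one_bounds)

lemma bump_pos_iff: "0 < n \<Longrightarrow> 0 < bump a b n x \<longleftrightarrow> x \<in> box a b"
proof -
  assume n: "0 < n"
  have "bump a b n x \<noteq> 0 \<longleftrightarrow> x \<in> box a b"
    using n unfolding bump_def mem_box_cart
    by (auto simp: flat_def zero_less_mult_iff)
  then show ?thesis using bump_bounds(1)[of a b n x] by linarith
qed

lemma Ck_bump: "Ck k (bump a b n)"
proof -
  have "Ck k (\<lambda>x. flat 1 (- n * a $ i + n * x $ i) * flat 1 (n * b $ i + (- n) * x $ i))" for i
    by (intro Ck_mult Ck_flat_affine)
  then have "Ck k (\<lambda>x. \<Prod>i\<in>UNIV. flat 1 (- n * a $ i + n * x $ i) * flat 1 (n * b $ i + (- n) * x $ i))"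
    by (intro Ck_prod) auto
  then show ?thesis
    by (auto simp: bump_def[abs_def] algebra_simps)
qed

lemma bump_tendsto_indicator:
  fixes a b x :: "real ^ 'n"
  shows
  "(\<lambda>n. bump a b (real (Suc n)) x) \<longlonglongrightarrow> indicator (box a b) x"
proof (cases "x \<in> box a b")
  case True
  have *: "(\<lambda>n. flat 1 (real (Suc n) * r)) \<longlonglongrightarrow> 1" if "0 < r" for r
  proof -
    have "(\<lambda>n. exp (- (1 / r) * inverse (real (Suc n)))) \<longlonglongrightarrow> exp (- (1 / r) * 0)"
      by (intro tendsto_exp tendsto_mult tendsto_const LIMSEQ_inverse_real_of_nat)
    also have "(\<lambda>n. exp (- (1 / r) * inverse (real (Suc n)))) = (\<lambda>n. flat 1 (real (Suc n) * r))"
    proof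
      fix n
      have "0 < real (Suc n) * r" using that by simp
      then show "exp (- (1 / r) * inverse (real (Suc n))) = flat 1 (real (Suc n) * r)"
        using that by (simp add: flat_def field_simps)
    qed
    finally show ?thesis by simp
  qed
  have "(\<lambda>n. bump a b (real (Suc n)) x) \<longlonglongrightarrow> (\<Prod>i\<in>(UNIV::'n set). 1 * 1)"
    unfolding bump_def
  proof (rule tendsto_prod, rule tendsto_mult)
    fix i :: 'n
    show "(\<lambda>n. flat 1 (real (Suc n) * (x $ i - a $ i))) \<longlonglongrightarrow> 1"
      "(\<lambda>n. flat 1 (real (Suc n) * (b $ i - x $ i))) \<longlonglongrightarrow> 1"
      using True by (simp_all only: mem_box_cart diff_gt_0_iff_gt *)
  qed
  then show ?thesis using True by simp
next
  case False
  then have "bump a b (real (Suc n)) x = 0" for n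
    using bump_pos_iff[of "real (Suc n)" a b x] bump_bounds(1)[of a b "real (Suc n)" x]
    by (simp del: of_nat_Suc)
  then show ?thesis using False by (simp del: of_nat_Suc)
qed

lemma test_funI:
  assumes "\<And>k. Ck k \<phi>" "\<And>x. x \<notin> K \<Longrightarrow> \<phi> x = 0" "compact K" "K \<subseteq> \<Omega>"
  shows "\<phi> \<in> test_fun \<Omega>"
proof -
  have "closure {x. \<phi> x \<noteq> 0} \<subseteq> K"
    using assms(2,3) by (intro closure_minimal compact_imp_closed) auto
  then show ?thesis
    using assms(1,3,4) unfolding test_fun_def
    by (auto simp: compact_closure intro: bounded_subset[OF compact_imp_bounded]
          dest: order_trans[OF closure_subset])
qed

lemma bump_test_fun: "cbox a b \<subseteq> \<Omega> \<Longrightarrow> 0 < n \<Longrightarrow> bump a b n \<in> test_fun \<Omega>"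
proof (rule test_funI[OF Ck_bump _ compact_cbox])
  fix x assume "0 < n" "x \<notin> cbox a b"
  then have "\<not> 0 < bump a b n x" using box_subset_cbox[of a b] by (auto simp: bump_pos_iff)
  then show "bump a b n x = 0" using bump_bounds(1)[of a b n x] by linarith
qed auto

lemma test_funE:
  assumes "\<phi> \<in> test_fun \<Omega>"
  obtains K D where "compact K" "K \<subseteq> \<Omega>" "\<And>x. x \<notin> K \<Longrightarrow> \<phi> x = 0"
    "\<And>k. Ck k \<phi>" "\<And>x. (\<phi> has_derivative D x) (at x)" "\<And>v. continuous_on UNIV (\<lambda>x. D x v)"
    "\<And>x v. x \<notin> K \<Longrightarrow> D x v = 0" "\<And>x. frechet_derivative \<phi> (at x) = D x"
proof -
  let ?K = "closure {x. \<phi> x \<noteq> 0}"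
  have K: "compact ?K" "?K \<subseteq> \<Omega>" and smooth: "\<And>k. Ck k \<phi>"
    using assms by (auto simp: test_fun_def)
  have zero: "\<phi> x = 0" if "x \<notin> ?K" for x
    using that closure_subset[of "{x. \<phi> x \<noteq> 0}"] by auto
  from smooth[of "Suc 0", unfolded Ck.simps(2)] obtain D where
    *: "\<forall>x. (\<phi> has_derivative D x) (at x)" "\<forall>v. Ck 0 (\<lambda>x. D x v)" by (elim exE conjE)
  have D: "(\<phi> has_derivative D x) (at x)" "continuous_on UNIV (\<lambda>x. D x v)" for x v
    by (rule *(1)[THEN spec], rule *(2)[THEN spec, unfolded Ck.simps(1)])
  have "D x v = 0" if x: "x \<notin> ?K" for x v
  proof -
    have "((\<lambda>y. 0) has_derivative D x) (at x)"
      using x zero by (intro has_derivative_transform_within_open[OF D(1)[of x], of "- ?K"]) (blast, blast, metis ComplD)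
    then have "D x = (\<lambda>v. 0)"
      by (rule has_derivative_unique) simp
    then show ?thesis by simp
  qed
  then show thesis
    using that[OF K zero smooth D(1) D(2) _ frechet_derivative_at[OF D(1), symmetric]] by blast
qed

lemma test_fun_compactE:
  assumes "\<phi> \<in> test_fun \<Omega>"
  obtains K where "compact K" "K \<subseteq> \<Omega>" "\<And>x. x \<notin> K \<Longrightarrow> \<phi> x = 0" "\<And>k. Ck k \<phi>"
  using assms by (auto elim!: test_funE)

lemma test_fun_mult:
  assumes "\<phi> \<in> test_fun \<Omega>" "\<And>k. Ck k \<psi>"
  shows "(\<lambda>x. \<phi> x * \<psi> x) \<in> test_fun \<Omega>"
proof -
  from assms(1) obtain K where "compact K" "K \<subseteq> \<Omega>" "\<And>x. x \<notin> K \<Longrightarrow> \<phi> x = 0" "\<And>k. Ck k \<phi>"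
    by (rule test_fun_compactE) blast
  note K = this
  show ?thesis
    by (rule test_funI[OF Ck_mult[OF K(4) assms(2)] _ K(1,2)]) (use K(3) in simp)
qed

lemma test_fun_lin_comb:
  assumes "\<phi> \<in> test_fun \<Omega>" "\<psi> \<in> test_fun \<Omega>"
  shows "(\<lambda>x. a * \<phi> x + b * \<psi> x) \<in> test_fun \<Omega>"
proof -
  from assms(1) obtain K where "compact K" "K \<subseteq> \<Omega>" "\<And>x. x \<notin> K \<Longrightarrow> \<phi> x = 0" "\<And>k. Ck k \<phi>"
    by (rule test_fun_compactE) blast
  note K = this
  from assms(2) obtain J where "compact J" "J \<subseteq> \<Omega>" "\<And>x. x \<notin> J \<Longrightarrow> \<psi> x = 0" "\<And>k. Ck k \<psi>"
    by (rule test_fun_compactE) blast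
  note J = this
  show ?thesis
  proof (rule test_funI)
    show "Ck k (\<lambda>x. a * \<phi> x + b * \<psi> x)" for k
      by (rule Ck_add[OF Ck_mult[OF Ck_const K(4)] Ck_mult[OF Ck_const J(4)]])
    show "compact (K \<union> J)" "K \<union> J \<subseteq> \<Omega>" using K J by auto
  qed (use K(3) J(3) in simp)
qed

lemma integrable_compact_support:
  fixes h :: "real ^ 'n \<Rightarrow> real"
  assumes "continuous_on UNIV h" "compact K" "\<And>x. x \<notin> K \<Longrightarrow> h x = 0"
  shows "integrable lborel h" "integrable lebesgue h"
proof -
  have "integrable lborel (\<lambda>x. indicator K x *\<^sub>R h x)"
    using assms by (intro borel_integrable_compact) (auto intro: continuous_on_subset)
  also have "(\<lambda>x. indicator K x *\<^sub>R h x) = h"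
    using assms(3) by (intro ext) (auto simp: indicator_def)
  finally show "integrable lborel h" .
  then show "integrable lebesgue h" by (simp add: integrable_completion)
qed

lemma bounded_compact_support:
  fixes h :: "real ^ 'n \<Rightarrow> real"
  assumes "continuous_on UNIV h" "compact K" "\<And>x. x \<notin> K \<Longrightarrow> h x = 0"
  obtains B where "0 \<le> B" "\<And>x. \<bar>h x\<bar> \<le> B"
proof -
  have "bounded (h ` K)"
    using assms(1,2) by (meson compact_continuous_image compact_imp_bounded continuous_on_subset subset_UNIV)
  then obtain B where "\<And>x. x \<in> K \<Longrightarrow> \<bar>h x\<bar> \<le> B" by (auto simp: bounded_iff)
  then have "\<bar>h x\<bar> \<le> max 0 B" for x
    using assms(3)[of x] by (cases "x \<in> K") (auto simp: max.coboundedI2)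
  then show thesis using that[of "max 0 B"] by auto
qed

section \<open>Integration by parts and the fundamental lemma\<close>

text \<open>The difference quotients of \<open>h\<close> in the direction \<open>v\<close> have vanishing integral by translation
  invariance, and they converge boundedly to the directional derivative.\<close>

lemma integral_derivative_compact_support:
  fixes h :: "real ^ 'n \<Rightarrow> real" and D :: "real ^ 'n \<Rightarrow> real ^ 'n \<Rightarrow> real"
  assumes h: "\<And>x. (h has_derivative D x) (at x)" and cont: "continuous_on UNIV (\<lambda>x. D x v)"
    and K: "compact K" "\<And>x. x \<notin> K \<Longrightarrow> h x = 0" "\<And>x. x \<notin> K \<Longrightarrow> D x v = 0"
  shows "(\<integral>x. D x v \<partial>lborel) = 0"
proof -
  obtain B where B: "0 \<le> B" "\<And>x. \<bar>D x v\<bar> \<le> B"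
    using bounded_compact_support[OF cont K(1,3)] by blast
  obtain R where R: "\<And>x. x \<in> K \<Longrightarrow> norm x \<le> R"
    using compact_imp_bounded[OF K(1)] by (auto simp: bounded_iff)
  have hc: "continuous_on UNIV h"
    by (meson h continuous_at_imp_continuous_on has_derivative_continuous)
  then have hm[measurable]: "h \<in> borel_measurable borel"
    by (rule borel_measurable_continuous_onI)
  have Dm[measurable]: "(\<lambda>x. D x v) \<in> borel_measurable borel"
    using cont by (rule borel_measurable_continuous_onI)
  have hi: "integrable lborel h"
    by (rule integrable_compact_support(1)[OF hc K(1,2)])
  have path: "((\<lambda>s. h (x + s *\<^sub>R v)) has_real_derivative D (x + s *\<^sub>R v) v) (at s)" for x s
  proof -
    have "((\<lambda>s. x + s *\<^sub>R v) has_derivative (\<lambda>r. r *\<^sub>R v)) (at s)"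
      by (auto intro!: derivative_eq_intros)
    from has_derivative_compose[OF this h] show ?thesis
      by (simp add: has_field_derivative_def mult_commute_abs
          linear_cmul[OF has_derivative_linear[OF h], of "x + s *\<^sub>R v"])
  qed
  define q where "q n x = (h (x + inverse (real (Suc n)) *\<^sub>R v) - h x) / inverse (real (Suc n))" for n x
  have qm[measurable]: "q n \<in> borel_measurable borel" for n
    unfolding q_def[abs_def] by measurable
  have q0: "(\<integral>x. q n x \<partial>lborel) = 0" for n
  proof -
    let ?c = "inverse (real (Suc n)) *\<^sub>R v"
    have "integrable lborel (\<lambda>x. h (?c + x))"
      using hi by (subst (asm) lborel_distr_plus[of ?c, symmetric]) (simp add: integrable_distr_eq)
    moreover have "(\<integral>x. h x \<partial>lborel) = (\<integral>x. h (?c + x) \<partial>lborel)"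
      by (subst lborel_distr_plus[of ?c, symmetric]) (simp add: integral_distr)
    ultimately show ?thesis
      using hi unfolding q_def by (simp add: add.commute del: of_nat_Suc)
  qed
  have lim: "(\<lambda>n. q n x) \<longlonglongrightarrow> D x v" for x
  proof -
    have "((\<lambda>s. (h (x + s *\<^sub>R v) - h x) / s) \<longlongrightarrow> D x v) (at 0)"
      using path[of x 0] by (simp add: DERIV_def)
    moreover have "filterlim (\<lambda>n. inverse (real (Suc n))) (at 0) sequentially"
      by (intro filterlim_atI LIMSEQ_inverse_real_of_nat always_eventually) simp
    ultimately show ?thesis
      unfolding q_def by (rule filterlim_compose)
  qed
  \<comment> \<open>The shifts have length at most \<open>norm v\<close>, so all difference quotients vanish outside one ball.\<close>
  have bound: "norm (q n x) \<le> B * indicator (cball 0 (R + norm v)) x" for n x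
  proof (cases "x \<in> cball 0 (R + norm v)")
    case True
    let ?r = "inverse (real (Suc n))"
    have "norm (h (x + ?r *\<^sub>R v) - h (x + 0 *\<^sub>R v)) \<le> B * norm (?r - 0)"
      by (rule field_differentiable_bound[OF convex_UNIV has_field_derivative_at_within[OF path]])
        (use B in auto)
    then have "norm (q n x) \<le> B"
      unfolding q_def norm_divide by (subst pos_divide_le_eq) auto
    then show ?thesis using True by simp
  next
    case False
    have "norm (inverse (real (Suc n)) *\<^sub>R v) \<le> norm v"
      by (simp add: mult_left_le_one_le inverse_le_1_iff)
    moreover have "norm x \<le> norm (x + inverse (real (Suc n)) *\<^sub>R v) + norm (inverse (real (Suc n)) *\<^sub>R v)"
      using norm_triangle_ineq4[of "x + inverse (real (Suc n)) *\<^sub>R v" "inverse (real (Suc n)) *\<^sub>R v"]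
      by simp
    ultimately have "R < norm x" "R < norm (x + inverse (real (Suc n)) *\<^sub>R v)"
      using False norm_ge_zero[of v] by (auto simp: dist_norm simp del: norm_ge_zero)
    then have "x \<notin> K" "x + inverse (real (Suc n)) *\<^sub>R v \<notin> K" using R by force+
    then show ?thesis using False K(2) by (simp add: q_def)
  qed
  have "(\<lambda>n. \<integral>x. q n x \<partial>lborel) \<longlonglongrightarrow> (\<integral>x. D x v \<partial>lborel)"
  proof (rule integral_dominated_convergence)
    show "integrable lborel (\<lambda>x. B * indicator (cball 0 (R + norm v)) x)"
      by (intro integrable_mult_right integrable_real_indicator)
        (simp, rule emeasure_bounded_finite[OF bounded_cball])
  qed (use lim bound in auto)
  then show ?thesis by (simp add: q0 LIMSEQ_const_iff)
qed

text \<open>Boxes form an intersection-stable generator of the Borel sets, so all Borel sets have vanishing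
  integral. Lebesgue measurable sets differ from Borel sets by null sets.\<close>

lemma AE_zero_if_box_integrals_zero:
  fixes m :: "real ^ 'n \<Rightarrow> real"
  assumes m: "integrable lebesgue m" and box: "\<And>a b. (\<integral>x\<in>box a b. m x \<partial>lebesgue) = 0"
  shows "AE x in lebesgue. m x = 0"
proof -
  have int: "set_integrable lebesgue A m" if "A \<in> sets lebesgue" for A
    using m that unfolding set_integrable_def by (intro integrable_mult_indicator)
  have borel: "A \<in> sets borel \<Longrightarrow> A \<in> sets lebesgue" for A :: "(real ^ 'n) set"
    by simp
  have all: "(\<integral>x\<in>UNIV. m x \<partial>lebesgue) = 0"
  proof -
    let ?B = "\<lambda>n::nat. box (- (real n *\<^sub>R One)) (real n *\<^sub>R One) :: (real ^ 'n) set"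
    have "incseq ?B" by (auto simp: incseq_def box_def intro: less_le_trans le_less_trans)
    then have "(\<lambda>n. \<integral>x\<in>?B n. m x \<partial>lebesgue) \<longlonglongrightarrow> (\<integral>x\<in>(\<Union>n. ?B n). m x \<partial>lebesgue)"
      by (intro set_integral_cont_up int) auto
    then show ?thesis by (simp add: box UN_box_eq_UNIV LIMSEQ_const_iff)
  qed
  have zero_borel: "(\<integral>x\<in>A. m x \<partial>lebesgue) = 0" if "A \<in> sets borel" for A
  proof -
    have "Int_stable (range (\<lambda>(a, b). box a b :: (real ^ 'n) set))"
      by (auto simp: Int_stable_def box_Int_box)
    moreover have "range (\<lambda>(a, b). box a b :: (real ^ 'n) set) \<subseteq> Pow UNIV" by auto
    moreover have "A \<in> sigma_sets UNIV (range (\<lambda>(a, b). box a b))"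
      using that by (simp add: borel_eq_box)
    ultimately show ?thesis
    proof (induction rule: sigma_sets_induct_disjoint)
      case (basic A)
      then show ?case using box by auto
    next
      case empty
      then show ?case by (simp add: set_lebesgue_integral_def)
    next
      case (compl A)
      then have A: "A \<in> sets borel" by (simp add: borel_eq_box)
      have "(\<integral>x\<in>A \<union> (UNIV - A). m x \<partial>lebesgue)
          = (\<integral>x\<in>A. m x \<partial>lebesgue) + (\<integral>x\<in>UNIV - A. m x \<partial>lebesgue)"
        using A by (intro set_integral_Un int) (auto intro!: borel)
      then show ?case using compl all by simp
    next
      case (union F)
      then have F: "F i \<in> sets borel" for i by (auto simp: borel_eq_box)
      have "(\<integral>x\<in>(\<Union>i. F i). m x \<partial>lebesgue) = (\<Sum>i. \<integral>x\<in>F i. m x \<partial>lebesgue)"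
        using F union(1) by (intro lebesgue_integral_countable_add int borel sets.countable_UN)
          (auto simp: disjoint_family_on_def intro: borel)
      then show ?case using union by simp
    qed
  qed
  show ?thesis
  proof (rule density_unique_real[OF m integrable_zero])
    fix A :: "(real ^ 'n) set" assume "A \<in> sets lebesgue"
    then obtain S N N' where A: "A = S \<union> N" "N \<subseteq> N'" "N' \<in> null_sets lborel" "S \<in> sets lborel"
      by (rule sets_completionE)
    then have S: "S \<in> sets borel" by simp
    have "N' \<in> null_sets lebesgue" using A(3) by (simp add: null_sets_completionI)
    then have "AE x in lebesgue. x \<in> A \<longleftrightarrow> x \<in> S"
      using A by (auto dest!: AE_not_in elim!: eventually_mono)
    then have "(\<integral>x\<in>A. m x \<partial>lebesgue) = (\<integral>x\<in>S. m x \<partial>lebesgue)"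
      using borel_measurable_integrable[OF int[OF \<open>A \<in> sets lebesgue\<close>, unfolded set_integrable_def]]
        borel_measurable_integrable[OF int[OF borel[OF S], unfolded set_integrable_def]]
      unfolding set_lebesgue_integral_def
      by (intro integral_cong_AE) (auto elim!: eventually_mono simp: indicator_def)
    then show "(\<integral>x\<in>A. m x \<partial>lebesgue) = (\<integral>x\<in>A. 0 \<partial>lebesgue)"
      using zero_borel[OF S] by (simp add: set_lebesgue_integral_def)
  qed
qed

lemma integrable_lebesgue_on_iff:
  fixes h :: "real ^ 'n \<Rightarrow> real"
  shows "open \<Omega> \<Longrightarrow> integrable (lebesgue_on \<Omega>) h \<longleftrightarrow> integrable lebesgue (\<lambda>x. indicator \<Omega> x * h x)"
  by (subst integrable_restrict_space) auto

lemma integral_lebesgue_on_eq: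
  fixes h :: "real ^ 'n \<Rightarrow> real"
  shows "open \<Omega> \<Longrightarrow> (\<integral>x. h x \<partial>lebesgue_on \<Omega>) = (\<integral>x. indicator \<Omega> x * h x \<partial>lebesgue)"
  by (subst integral_restrict_space) auto

text \<open>Multiplication by one bump function makes \<open>g\<close> globally integrable near a given box. Further
  bump factors approximate the indicator functions of all boxes.\<close>

lemma fundamental_lemma:
  fixes g :: "real ^ 'n \<Rightarrow> real"
  assumes \<Omega>: "open \<Omega>" and int: "\<And>\<phi>. \<phi> \<in> test_fun \<Omega> \<Longrightarrow> integrable (lebesgue_on \<Omega>) (\<lambda>x. g x * \<phi> x)"
    and zero: "\<And>\<phi>. \<phi> \<in> test_fun \<Omega> \<Longrightarrow> ip \<Omega> g \<phi> = 0"
  shows "AE x in lebesgue_on \<Omega>. g x = 0"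
proof -
  have *: "AE x in lebesgue. x \<in> box c d \<longrightarrow> x \<in> \<Omega> \<longrightarrow> g x = 0" if cd: "cbox c d \<subseteq> \<Omega>" for c d
  proof -
    define m where "m x = indicator \<Omega> x * (g x * bump c d 1 x)" for x
    have mi: "integrable lebesgue m"
      using int[OF bump_test_fun[OF cd]] \<Omega> by (simp add: m_def[abs_def] integrable_lebesgue_on_iff)
    have "AE x in lebesgue. m x = 0"
    proof (rule AE_zero_if_box_integrals_zero[OF mi])
      fix a b :: "real ^ 'n"
      have tf: "(\<lambda>x. bump c d 1 x * bump a b (real (Suc n)) x) \<in> test_fun \<Omega>" for n
        by (intro test_fun_mult bump_test_fun cd Ck_bump) simp
      have "(\<integral>x. m x * bump a b (real (Suc n)) x \<partial>lebesgue) = 0" for n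
        using zero[OF tf, of n] \<Omega>
        by (simp add: ip_def integral_lebesgue_on_eq m_def mult.assoc del: of_nat_Suc)
      moreover have "(\<lambda>n. \<integral>x. m x * bump a b (real (Suc n)) x \<partial>lebesgue)
          \<longlonglongrightarrow> (\<integral>x. m x * indicator (box a b) x \<partial>lebesgue)"
      proof (rule integral_dominated_convergence)
        show "integrable lebesgue (\<lambda>x. norm (m x))" using mi by simp
        have "continuous_on UNIV (bump a b (real (Suc n)))" for n
          by (rule Ck_imp_continuous[OF Ck_bump[of 0]])
        then have "bump a b (real (Suc n)) \<in> borel_measurable lebesgue" for n
          by (intro measurable_completion) (simp add: borel_measurable_continuous_onI del: of_nat_Suc)
        then show "(\<lambda>x. m x * bump a b (real (Suc n)) x) \<in> borel_measurable lebesgue" for n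
          using mi by (intro borel_measurable_times) auto
        show "(\<lambda>x. m x * indicator (box a b) x) \<in> borel_measurable lebesgue"
          using mi by (intro borel_measurable_times borel_measurable_indicator) auto
        show "AE x in lebesgue. norm (m x * bump a b (real (Suc n)) x) \<le> norm (m x)" for n
          using bump_bounds[of a b "real (Suc n)"]
          by (intro AE_I2) (simp add: abs_mult mult_left_le del: of_nat_Suc)
        show "AE x in lebesgue. (\<lambda>n. m x * bump a b (real (Suc n)) x) \<longlonglongrightarrow> m x * indicator (box a b) x"
          by (intro AE_I2 tendsto_mult tendsto_const bump_tendsto_indicator)
      qed
      ultimately have "(\<integral>x. m x * indicator (box a b) x \<partial>lebesgue) = 0"
        by (simp add: LIMSEQ_const_iff)
      then show "(\<integral>x\<in>box a b. m x \<partial>lebesgue) = 0"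
        by (simp add: set_lebesgue_integral_def mult.commute)
    qed
    then show ?thesis
    proof (eventually_elim, intro impI)
      fix x assume "m x = 0" "x \<in> box c d" "x \<in> \<Omega>"
      then show "g x = 0" using bump_pos_iff[of 1 c d x] by (auto simp: m_def)
    qed
  qed
  obtain \<F> where F: "\<F> \<subseteq> {B. \<exists>c d. B = box c d \<and> cbox c d \<subseteq> \<Omega>}" "countable \<F>"
      "\<Union>\<F> = \<Union>{B. \<exists>c d. B = box c d \<and> cbox c d \<subseteq> \<Omega>}"
    by (rule Lindelof[of "{B. \<exists>c d. B = box c d \<and> cbox c d \<subseteq> \<Omega>}"]) auto
  have "\<Omega> \<subseteq> \<Union>\<F>"
  proof
    fix x assume "x \<in> \<Omega>"
    with open_contains_cbox[OF \<Omega>] obtain c d where "cbox c d \<subseteq> \<Omega>" "x \<in> box c d" by metis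
    then show "x \<in> \<Union>\<F>" unfolding F(3) by blast
  qed
  moreover have "AE x in lebesgue. \<forall>B\<in>\<F>. x \<in> B \<longrightarrow> x \<in> \<Omega> \<longrightarrow> g x = 0"
    using F(1) * by (intro AE_ball_countable' F(2)) blast
  ultimately have "AE x in lebesgue. x \<in> \<Omega> \<longrightarrow> g x = 0"
    by (auto elim!: eventually_mono)
  then show ?thesis using \<Omega> by (subst AE_restrict_space_iff) auto
qed

lemma continuous_compact_support_lebesgue_on:
  fixes h :: "real ^ 'n \<Rightarrow> real"
  assumes "open \<Omega>" "continuous_on UNIV h" "compact K" "K \<subseteq> \<Omega>" "\<And>x. x \<notin> K \<Longrightarrow> h x = 0"
  shows "integrable (lebesgue_on \<Omega>) h" "(\<integral>x. h x \<partial>lebesgue_on \<Omega>) = (\<integral>x. h x \<partial>lborel)"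
proof -
  have *: "(\<lambda>x. indicator \<Omega> x * h x) = h"
    using assms(4,5) by (intro ext) (metis indicator_simps mult_1 mult_zero_right subsetD)
  show "integrable (lebesgue_on \<Omega>) h"
    using assms by (simp add: integrable_lebesgue_on_iff * integrable_compact_support(2))
  show "(\<integral>x. h x \<partial>lebesgue_on \<Omega>) = (\<integral>x. h x \<partial>lborel)"
    using assms by (simp add: integral_lebesgue_on_eq * integral_completion borel_measurable_continuous_onI)
qed

text \<open>The directional derivative of the product of two test functions has vanishing integral.\<close>

lemma integration_by_parts:
  fixes \<phi> \<psi> :: "real ^ 'n \<Rightarrow> real"
  assumes \<Omega>: "open \<Omega>" and \<phi>: "\<phi> \<in> test_fun \<Omega>" and \<psi>: "\<psi> \<in> test_fun \<Omega>"
  shows "ip \<Omega> \<phi> (\<lambda>x. frechet_derivative \<psi> (at x) v) = - ip \<Omega> (\<lambda>x. frechet_derivative \<phi> (at x) v) \<psi>"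
proof -
  obtain K D where K: "compact K" "K \<subseteq> \<Omega>" "\<And>x. x \<notin> K \<Longrightarrow> \<phi> x = 0" "\<And>k. Ck k \<phi>"
    and D: "\<And>x. (\<phi> has_derivative D x) (at x)" "\<And>v. continuous_on UNIV (\<lambda>x. D x v)"
      "\<And>x v. x \<notin> K \<Longrightarrow> D x v = 0" "\<And>x. frechet_derivative \<phi> (at x) = D x"
    by (rule test_funE[OF \<phi>]) blast
  obtain J E where J: "compact J" "J \<subseteq> \<Omega>" "\<And>x. x \<notin> J \<Longrightarrow> \<psi> x = 0" "\<And>k. Ck k \<psi>"
    and E: "\<And>x. (\<psi> has_derivative E x) (at x)" "\<And>v. continuous_on UNIV (\<lambda>x. E x v)"
      "\<And>x v. x \<notin> J \<Longrightarrow> E x v = 0" "\<And>x. frechet_derivative \<psi> (at x) = E x"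
    by (rule test_funE[OF \<psi>]) blast
  have c: "continuous_on UNIV \<phi>" "continuous_on UNIV \<psi>"
    using K(4)[of 0] J(4)[of 0] by auto
  have c1: "continuous_on UNIV (\<lambda>x. \<phi> x * E x v)" "continuous_on UNIV (\<lambda>x. D x v * \<psi> x)"
    by (intro continuous_on_mult c D(2) E(2))+
  have *: "((\<lambda>x. \<phi> x * \<psi> x) has_derivative (\<lambda>v. \<phi> x * E x v + D x v * \<psi> x)) (at x)" for x
    using has_derivative_mult[OF D(1) E(1)] .
  have "(\<integral>x. \<phi> x * E x v + D x v * \<psi> x \<partial>lborel) = 0"
    by (rule integral_derivative_compact_support[OF * _ K(1)])
      (use K(3) D(3) in \<open>auto intro!: continuous_on_add c1\<close>)
  moreover have i: "integrable lborel (\<lambda>x. \<phi> x * E x v)" "integrable lborel (\<lambda>x. D x v * \<psi> x)"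
    by (rule integrable_compact_support[OF c1(1) K(1)] integrable_compact_support[OF c1(2) K(1)],
      use K(3) D(3) in simp)+
  ultimately have "(\<integral>x. \<phi> x * E x v \<partial>lborel) = - (\<integral>x. D x v * \<psi> x \<partial>lborel)"
    by simp
  moreover have "(\<integral>x. \<phi> x * E x v \<partial>lebesgue_on \<Omega>) = (\<integral>x. \<phi> x * E x v \<partial>lborel)"
    by (rule continuous_compact_support_lebesgue_on[OF \<Omega> c1(1) K(1,2)]) (use K(3) in simp)
  moreover have "(\<integral>x. D x v * \<psi> x \<partial>lebesgue_on \<Omega>) = (\<integral>x. D x v * \<psi> x \<partial>lborel)"
    by (rule continuous_compact_support_lebesgue_on[OF \<Omega> c1(2) K(1,2)]) (use D(3) in simp)
  ultimately show ?thesis by (simp add: ip_def D(4) E(4))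
qed

section \<open>The space \<open>H10\<close>\<close>

lemma L2_measurable: "v \<in> L2 \<Omega> \<Longrightarrow> v \<in> borel_measurable (lebesgue_on \<Omega>)"
  by (simp add: L2_def)

lemma L2_integrable_mult:
  fixes v w :: "real ^ 'n \<Rightarrow> real"
  assumes "v \<in> L2 \<Omega>" "w \<in> L2 \<Omega>"
  shows "integrable (lebesgue_on \<Omega>) (\<lambda>x. v x * w x)"
proof (rule Bochner_Integration.integrable_bound)
  show "integrable (lebesgue_on \<Omega>) (\<lambda>x. (norm (v x))\<^sup>2 + (norm (w x))\<^sup>2)"
    using assms by (simp add: L2_def)
  show "AE x in lebesgue_on \<Omega>. norm (v x * w x) \<le> norm ((norm (v x))\<^sup>2 + (norm (w x))\<^sup>2)"
  proof (rule AE_I2)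
    fix x
    have "0 \<le> (\<bar>v x\<bar> - \<bar>w x\<bar>)\<^sup>2" "0 \<le> \<bar>v x\<bar> * \<bar>w x\<bar>" by simp_all
    then have "\<bar>v x\<bar> * \<bar>w x\<bar> \<le> (v x)\<^sup>2 + (w x)\<^sup>2"
      unfolding power2_diff power2_abs by linarith
    then show "norm (v x * w x) \<le> norm ((norm (v x))\<^sup>2 + (norm (w x))\<^sup>2)"
      by (simp add: abs_mult)
  qed
qed (use assms in \<open>auto simp: L2_def intro!: borel_measurable_times\<close>)

lemma norm_lin_comb_sq_le:
  fixes y z :: "'b::real_normed_vector"
  shows "(norm (a *\<^sub>R y + b *\<^sub>R z))\<^sup>2 \<le> 2 * a\<^sup>2 * (norm y)\<^sup>2 + 2 * b\<^sup>2 * (norm z)\<^sup>2"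
proof -
  have "norm (a *\<^sub>R y + b *\<^sub>R z) \<le> \<bar>a\<bar> * norm y + \<bar>b\<bar> * norm z"
    using norm_triangle_ineq[of "a *\<^sub>R y" "b *\<^sub>R z"] by simp
  then have "(norm (a *\<^sub>R y + b *\<^sub>R z))\<^sup>2 \<le> (\<bar>a\<bar> * norm y + \<bar>b\<bar> * norm z)\<^sup>2"
    by (intro power_mono) auto
  also have "\<dots> \<le> 2 * (\<bar>a\<bar> * norm y)\<^sup>2 + 2 * (\<bar>b\<bar> * norm z)\<^sup>2"
    using sum_squares_bound[of "\<bar>a\<bar> * norm y" "\<bar>b\<bar> * norm z"] by (simp add: power2_sum)
  finally show ?thesis by (simp add: power_mult_distrib)
qed

lemma L2_lin_comb:
  fixes v w :: "real ^ 'n \<Rightarrow> 'b::euclidean_space"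
  assumes "v \<in> L2 \<Omega>" "w \<in> L2 \<Omega>"
  shows "(\<lambda>x. a *\<^sub>R v x + b *\<^sub>R w x) \<in> L2 \<Omega>"
proof -
  have [measurable]: "v \<in> borel_measurable (lebesgue_on \<Omega>)" "w \<in> borel_measurable (lebesgue_on \<Omega>)"
    using assms by (auto simp: L2_def)
  have "integrable (lebesgue_on \<Omega>) (\<lambda>x. (norm (a *\<^sub>R v x + b *\<^sub>R w x))\<^sup>2)"
  proof (rule Bochner_Integration.integrable_bound)
    show "integrable (lebesgue_on \<Omega>) (\<lambda>x. 2 * a\<^sup>2 * (norm (v x))\<^sup>2 + 2 * b\<^sup>2 * (norm (w x))\<^sup>2)"
      using assms by (simp add: L2_def)
  qed (auto intro!: AE_I2 order_trans[OF norm_lin_comb_sq_le])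
  then show ?thesis by (simp add: L2_def)
qed

lemma ip_lin_comb_left:
  fixes v w :: "real ^ 'n \<Rightarrow> real"
  assumes "v \<in> L2 \<Omega>" "w \<in> L2 \<Omega>" "\<phi> \<in> L2 \<Omega>"
  shows "ip \<Omega> (\<lambda>x. a * v x + b * w x) \<phi> = a * ip \<Omega> v \<phi> + b * ip \<Omega> w \<phi>"
  using L2_integrable_mult[OF assms(1,3)] L2_integrable_mult[OF assms(2,3)]
  by (simp add: ip_def distrib_right mult.assoc)

lemma ip_commute: "ip \<Omega> v w = ip \<Omega> w v"
  by (simp add: ip_def mult.commute)

lemma ip_cong_AE:
  fixes v w :: "real ^ 'n \<Rightarrow> real"
  assumes "AE x in lebesgue_on \<Omega>. v x = w x" "v \<in> L2 \<Omega>" "w \<in> L2 \<Omega>" "\<phi> \<in> L2 \<Omega>"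
  shows "ip \<Omega> \<phi> v = ip \<Omega> \<phi> w"
  unfolding ip_def
  using assms by (intro integral_cong_AE) (auto simp: L2_def elim!: eventually_mono)

lemma test_fun_L2:
  assumes "open \<Omega>" "\<phi> \<in> test_fun \<Omega>"
  shows "\<phi> \<in> L2 \<Omega>" "(\<lambda>x. frechet_derivative \<phi> (at x) v) \<in> L2 \<Omega>"
    "(\<lambda>x. \<chi> i. frechet_derivative \<phi> (at x) (axis i 1)) \<in> L2 \<Omega>"
proof -
  obtain K D where K: "compact K" "K \<subseteq> \<Omega>" "\<And>x. x \<notin> K \<Longrightarrow> \<phi> x = 0" "\<And>k. Ck k \<phi>"
    and D: "\<And>x. (\<phi> has_derivative D x) (at x)" "\<And>v. continuous_on UNIV (\<lambda>x. D x v)"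
      "\<And>x v. x \<notin> K \<Longrightarrow> D x v = 0" "\<And>x. frechet_derivative \<phi> (at x) = D x"
    by (rule test_funE[OF assms(2)]) blast
  have *: "h \<in> L2 \<Omega>" if h: "continuous_on UNIV h" "\<And>x. x \<notin> K \<Longrightarrow> h x = 0"
    for h :: "real ^ 'a \<Rightarrow> 'c::euclidean_space"
  proof -
    have "integrable (lebesgue_on \<Omega>) (\<lambda>x. (norm (h x))\<^sup>2)"
      by (rule continuous_compact_support_lebesgue_on[OF assms(1) _ K(1,2)])
        (auto intro!: continuous_intros h simp: h(2))
    moreover have "h \<in> borel_measurable (lebesgue_on \<Omega>)"
      by (intro measurable_restrict_space1 measurable_completion) (simp add: borel_measurable_continuous_onI h)
    ultimately show ?thesis by (simp add: L2_def)
  qed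
  show "\<phi> \<in> L2 \<Omega>" using K(3) K(4)[of 0] by (intro *) auto
  show "(\<lambda>x. frechet_derivative \<phi> (at x) v) \<in> L2 \<Omega>" using D by (intro *) auto
  show "(\<lambda>x. \<chi> i. frechet_derivative \<phi> (at x) (axis i 1)) \<in> L2 \<Omega>"
    unfolding D(4) by (intro * continuous_on_vec_lambda D(2)) (simp add: D(3) vec_eq_iff)
qed

lemma L2_component:
  fixes g :: "real ^ 'n \<Rightarrow> real ^ 'm"
  assumes "g \<in> L2 \<Omega>"
  shows "(\<lambda>x. g x $ i) \<in> L2 \<Omega>"
proof -
  have m: "(\<lambda>x. g x $ i) \<in> borel_measurable (lebesgue_on \<Omega>)"
    using assms unfolding L2_def cart_eq_inner_axis by auto
  have "integrable (lebesgue_on \<Omega>) (\<lambda>x. (norm (g x $ i))\<^sup>2)"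
  proof (rule Bochner_Integration.integrable_bound)
    show "integrable (lebesgue_on \<Omega>) (\<lambda>x. (norm (g x))\<^sup>2)" using assms by (simp add: L2_def)
    show "AE x in lebesgue_on \<Omega>. norm ((norm (g x $ i))\<^sup>2) \<le> norm ((norm (g x))\<^sup>2)"
      by (intro AE_I2) (simp add: power_mono[OF component_le_norm_cart abs_ge_zero, of _ _ 2, simplified])
  qed (use m in simp)
  with m show ?thesis by (simp add: L2_def)
qed

text \<open>This is what gives \<^const>\<open>grad\<close> a meaning, since it is defined by an arbitrary choice.\<close>

lemma weak_gradient_unique:
  assumes \<Omega>: "open \<Omega>" and g: "weak_gradient \<Omega> w g" and h: "weak_gradient \<Omega> w h"
  shows "AE x in lebesgue_on \<Omega>. g x = h x"
proof -
  have L: "(\<lambda>x. g x $ i) \<in> L2 \<Omega>" "(\<lambda>x. h x $ i) \<in> L2 \<Omega>" for i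
    using g h by (auto simp: weak_gradient_def intro: L2_component)
  have d: "(\<lambda>x. 1 * (g x $ i) + (-1) * (h x $ i)) \<in> L2 \<Omega>" for i
    using L2_lin_comb[OF L, of 1 i "-1" i] by simp
  have "AE x in lebesgue_on \<Omega>. 1 * (g x $ i) + (-1) * (h x $ i) = 0" for i
  proof (rule fundamental_lemma[OF \<Omega>])
    fix \<phi> assume \<phi>: "\<phi> \<in> test_fun \<Omega>"
    show "integrable (lebesgue_on \<Omega>) (\<lambda>x. (1 * (g x $ i) + (-1) * (h x $ i)) * \<phi> x)"
      by (rule L2_integrable_mult[OF d test_fun_L2(1)[OF \<Omega> \<phi>]])
    have "ip \<Omega> (\<lambda>x. g x $ i) \<phi> = ip \<Omega> (\<lambda>x. h x $ i) \<phi>"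
      using g h \<phi> by (auto simp: weak_gradient_def)
    then show "ip \<Omega> (\<lambda>x. 1 * (g x $ i) + (-1) * (h x $ i)) \<phi> = 0"
      by (subst ip_lin_comb_left[OF L test_fun_L2(1)[OF \<Omega> \<phi>]]) simp
  qed
  then have "AE x in lebesgue_on \<Omega>. \<forall>i\<in>UNIV. g x $ i = h x $ i"
    by (intro AE_ball_countable') (auto simp: countable_finite)
  then show ?thesis by (auto simp: vec_eq_iff)
qed

lemma weak_gradient_grad: "w \<in> H1 \<Omega> \<Longrightarrow> weak_gradient \<Omega> w (grad \<Omega> w)"
  using someI_ex[of "weak_gradient \<Omega> w"] by (auto simp: grad_def H1_def)

lemma H1_L2: "w \<in> H1 \<Omega> \<Longrightarrow> w \<in> L2 \<Omega>"
  by (simp add: H1_def)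

lemma H10_L2: "w \<in> H10 \<Omega> \<Longrightarrow> w \<in> L2 \<Omega>"
  by (simp add: H10_def H1_def)

lemma weak_gradient_lin_comb:
  fixes v w :: "real ^ 'n \<Rightarrow> real"
  assumes \<Omega>: "open \<Omega>" and vw: "v \<in> L2 \<Omega>" "w \<in> L2 \<Omega>"
    and g: "weak_gradient \<Omega> v g" and h: "weak_gradient \<Omega> w h"
  shows "weak_gradient \<Omega> (\<lambda>x. a * v x + b * w x) (\<lambda>x. a *\<^sub>R g x + b *\<^sub>R h x)"
proof -
  have gh: "g \<in> L2 \<Omega>" "h \<in> L2 \<Omega>" using g h by (auto simp: weak_gradient_def)
  show ?thesis
    unfolding weak_gradient_def
  proof (intro conjI ballI allI L2_lin_comb gh)
    fix \<phi> i assume \<phi>: "\<phi> \<in> test_fun \<Omega>"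
    have "ip \<Omega> (\<lambda>x. a * v x + b * w x) (\<lambda>x. frechet_derivative \<phi> (at x) (axis i 1))
        = - (a * ip \<Omega> (\<lambda>x. g x $ i) \<phi> + b * ip \<Omega> (\<lambda>x. h x $ i) \<phi>)"
      using g h \<phi> by (simp add: ip_lin_comb_left[OF vw test_fun_L2(2)[OF \<Omega> \<phi>]] weak_gradient_def)
    also have "\<dots> = - ip \<Omega> (\<lambda>x. (a *\<^sub>R g x + b *\<^sub>R h x) $ i) \<phi>"
      using ip_lin_comb_left[OF L2_component[OF gh(1)] L2_component[OF gh(2)] test_fun_L2(1)[OF \<Omega> \<phi>]]
      by simp
    finally show "ip \<Omega> (\<lambda>x. a * v x + b * w x) (\<lambda>x. frechet_derivative \<phi> (at x) (axis i 1))
        = - ip \<Omega> (\<lambda>x. (a *\<^sub>R g x + b *\<^sub>R h x) $ i) \<phi>" .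
  qed
qed

lemma H1_lin_comb:
  fixes v w :: "real ^ 'n \<Rightarrow> real"
  assumes "open \<Omega>" "v \<in> H1 \<Omega>" "w \<in> H1 \<Omega>"
  shows "(\<lambda>x. a * v x + b * w x) \<in> H1 \<Omega>"
  using weak_gradient_lin_comb[OF assms(1) H1_L2[OF assms(2)] H1_L2[OF assms(3)]
      weak_gradient_grad[OF assms(2)] weak_gradient_grad[OF assms(3)], of a b]
    L2_lin_comb[OF H1_L2[OF assms(2)] H1_L2[OF assms(3)], of a b]
  by (auto simp: H1_def)

lemma test_fun_H1:
  assumes "open \<Omega>" "\<phi> \<in> test_fun \<Omega>"
  shows "\<phi> \<in> H1 \<Omega>"
proof -
  have "weak_gradient \<Omega> \<phi> (\<lambda>x. \<chi> i. frechet_derivative \<phi> (at x) (axis i 1))"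
    using test_fun_L2(3)[OF assms] integration_by_parts[OF assms] by (simp add: weak_gradient_def)
  then show ?thesis using test_fun_L2(1)[OF assms] by (auto simp: H1_def)
qed

lemma H1_norm_nonneg: "0 \<le> H1_norm \<Omega> w"
  by (simp add: H1_norm_def Bochner_Integration.integral_nonneg)

text \<open>This weak substitute for the triangle inequality suffices for passing to limits in
  \<^const>\<open>H10\<close>.\<close>

lemma H1_norm_lin_comb_sq_le:
  fixes v w :: "real ^ 'n \<Rightarrow> real"
  assumes \<Omega>: "open \<Omega>" and v: "v \<in> H1 \<Omega>" and w: "w \<in> H1 \<Omega>"
  shows "(H1_norm \<Omega> (\<lambda>x. a * v x + b * w x))\<^sup>2 \<le> 2 * a\<^sup>2 * (H1_norm \<Omega> v)\<^sup>2 + 2 * b\<^sup>2 * (H1_norm \<Omega> w)\<^sup>2"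
proof -
  let ?u = "\<lambda>x. a * v x + b * w x"
  have u: "?u \<in> H1 \<Omega>" by (rule H1_lin_comb[OF assms])
  have sq: "(H1_norm \<Omega> z)\<^sup>2 = (\<integral>x. (z x)\<^sup>2 + (norm (grad \<Omega> z x))\<^sup>2 \<partial>lebesgue_on \<Omega>)" for z
    by (simp add: H1_norm_def Bochner_Integration.integral_nonneg)
  have int: "integrable (lebesgue_on \<Omega>) (\<lambda>x. (z x)\<^sup>2 + (norm (grad \<Omega> z x))\<^sup>2)" if "z \<in> H1 \<Omega>" for z
    using weak_gradient_grad[OF that] H1_L2[OF that] by (auto simp: L2_def weak_gradient_def)
  have "AE x in lebesgue_on \<Omega>. grad \<Omega> ?u x = a *\<^sub>R grad \<Omega> v x + b *\<^sub>R grad \<Omega> w x"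
    by (rule weak_gradient_unique[OF \<Omega> weak_gradient_grad[OF u]])
      (rule weak_gradient_lin_comb[OF \<Omega> H1_L2[OF v] H1_L2[OF w] weak_gradient_grad[OF v] weak_gradient_grad[OF w]])
  then have "(H1_norm \<Omega> ?u)\<^sup>2 \<le> (\<integral>x. 2 * a\<^sup>2 * ((v x)\<^sup>2 + (norm (grad \<Omega> v x))\<^sup>2)
      + 2 * b\<^sup>2 * ((w x)\<^sup>2 + (norm (grad \<Omega> w x))\<^sup>2) \<partial>lebesgue_on \<Omega>)"
    unfolding sq
  proof (intro integral_mono_AE int u)
    show "AE x in lebesgue_on \<Omega>. (?u x)\<^sup>2 + (norm (grad \<Omega> ?u x))\<^sup>2
        \<le> 2 * a\<^sup>2 * ((v x)\<^sup>2 + (norm (grad \<Omega> v x))\<^sup>2) + 2 * b\<^sup>2 * ((w x)\<^sup>2 + (norm (grad \<Omega> w x))\<^sup>2)"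
      if "AE x in lebesgue_on \<Omega>. grad \<Omega> ?u x = a *\<^sub>R grad \<Omega> v x + b *\<^sub>R grad \<Omega> w x"
      using that
    proof eventually_elim
      case (elim x)
      then show ?case
        using norm_lin_comb_sq_le[of a "v x" b "w x"]
          norm_lin_comb_sq_le[of a "grad \<Omega> v x" b "grad \<Omega> w x"]
        by (simp add: algebra_simps)
    qed
  qed (use int[OF v] int[OF w] in simp)
  also have "\<dots> = 2 * a\<^sup>2 * (H1_norm \<Omega> v)\<^sup>2 + 2 * b\<^sup>2 * (H1_norm \<Omega> w)\<^sup>2"
    unfolding sq using int[OF v] int[OF w] by simp
  finally show ?thesis .
qed

lemma H10_lin_comb:
  fixes v w :: "real ^ 'n \<Rightarrow> real"
  assumes \<Omega>: "open \<Omega>" and v: "v \<in> H10 \<Omega>" and w: "w \<in> H10 \<Omega>"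
  shows "(\<lambda>x. a * v x + b * w x) \<in> H10 \<Omega>"
proof -
  obtain \<phi> \<psi> where \<phi>: "\<And>n. \<phi> n \<in> test_fun \<Omega>" "(\<lambda>n. H1_norm \<Omega> (\<lambda>x. v x - \<phi> n x)) \<longlonglongrightarrow> 0"
    and \<psi>: "\<And>n. \<psi> n \<in> test_fun \<Omega>" "(\<lambda>n. H1_norm \<Omega> (\<lambda>x. w x - \<psi> n x)) \<longlonglongrightarrow> 0"
    using v w by (auto simp: H10_def)
  have vw: "v \<in> H1 \<Omega>" "w \<in> H1 \<Omega>" using v w by (auto simp: H10_def)
  let ?z = "\<lambda>n x. a * v x + b * w x - (a * \<phi> n x + b * \<psi> n x)"
  have bound: "(H1_norm \<Omega> (?z n))\<^sup>2 \<le> 2 * a\<^sup>2 * (H1_norm \<Omega> (\<lambda>x. v x - \<phi> n x))\<^sup>2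
      + 2 * b\<^sup>2 * (H1_norm \<Omega> (\<lambda>x. w x - \<psi> n x))\<^sup>2" for n
  proof -
    have "(\<lambda>x. v x - \<phi> n x) \<in> H1 \<Omega>" "(\<lambda>x. w x - \<psi> n x) \<in> H1 \<Omega>"
      using H1_lin_comb[OF \<Omega> vw(1) test_fun_H1[OF \<Omega> \<phi>(1)], of 1 "-1" n]
        H1_lin_comb[OF \<Omega> vw(2) test_fun_H1[OF \<Omega> \<psi>(1)], of 1 "-1" n] by simp_all
    from H1_norm_lin_comb_sq_le[OF \<Omega> this, of a b] show ?thesis
      by (simp add: algebra_simps)
  qed
  have "(\<lambda>n. 2 * a\<^sup>2 * (H1_norm \<Omega> (\<lambda>x. v x - \<phi> n x))\<^sup>2
      + 2 * b\<^sup>2 * (H1_norm \<Omega> (\<lambda>x. w x - \<psi> n x))\<^sup>2) \<longlonglongrightarrow> 2 * a\<^sup>2 * 0\<^sup>2 + 2 * b\<^sup>2 * 0\<^sup>2"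
    by (intro tendsto_intros \<phi>(2) \<psi>(2))
  then have lim: "(\<lambda>n. 2 * a\<^sup>2 * (H1_norm \<Omega> (\<lambda>x. v x - \<phi> n x))\<^sup>2
      + 2 * b\<^sup>2 * (H1_norm \<Omega> (\<lambda>x. w x - \<psi> n x))\<^sup>2) \<longlonglongrightarrow> 0" by simp
  have "(\<lambda>n. (H1_norm \<Omega> (?z n))\<^sup>2) \<longlonglongrightarrow> 0"
    by (rule tendsto_sandwich[OF _ _ tendsto_const lim]) (auto intro!: always_eventually bound)
  then have "(\<lambda>n. sqrt ((H1_norm \<Omega> (?z n))\<^sup>2)) \<longlonglongrightarrow> sqrt 0"
    by (rule tendsto_real_sqrt)
  then have "(\<lambda>n. H1_norm \<Omega> (?z n)) \<longlonglongrightarrow> 0"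
    by (simp add: H1_norm_nonneg)
  moreover have "(\<lambda>x. a * \<phi> n x + b * \<psi> n x) \<in> test_fun \<Omega>" for n
    by (rule test_fun_lin_comb[OF \<phi>(1) \<psi>(1)])
  ultimately show ?thesis
    using H1_lin_comb[OF \<Omega> vw] unfolding H10_def
    by (auto intro!: exI[of _ "\<lambda>n x. a * \<phi> n x + b * \<psi> n x"])
qed

lemma H10_scale: "open \<Omega> \<Longrightarrow> v \<in> H10 \<Omega> \<Longrightarrow> (\<lambda>x. a * v x) \<in> H10 \<Omega>"
  using H10_lin_comb[of \<Omega> v v a 0] by simp

lemma H1_norm_zero:
  assumes "open \<Omega>"
  shows "H1_norm \<Omega> (\<lambda>x::real ^ 'n. 0) = 0"
proof -
  have "(\<lambda>x::real ^ 'n. 0 * indicator {} x + 0 * indicator {} x :: real) \<in> test_fun \<Omega>"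
    by (rule test_funI[of _ "{}"]) (auto simp: Ck_const simp del: Ck.simps)
  then have "(\<lambda>x::real ^ 'n. 0) \<in> H1 \<Omega>" using test_fun_H1[OF assms] by simp
  from H1_norm_lin_comb_sq_le[OF assms this this, of 0 0] show ?thesis by simp
qed

lemma test_fun_H10: "open \<Omega> \<Longrightarrow> \<phi> \<in> test_fun \<Omega> \<Longrightarrow> \<phi> \<in> H10 \<Omega>"
  by (auto simp: H10_def test_fun_H1 H1_norm_zero intro!: exI[of _ "\<lambda>n. \<phi>"])

section \<open>Duality between the norms\<close>

lemma nn_integral_abs_mult_le:
  fixes v w :: "real ^ 'n \<Rightarrow> real"
  assumes "w \<in> borel_measurable (lebesgue_on \<Omega>)"
  shows "(\<integral>\<^sup>+x. ennreal \<bar>v x * w x\<bar> \<partial>lebesgue_on \<Omega>) \<le> Linf_norm \<Omega> v * L1_norm \<Omega> w"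
proof -
  have "AE x in lebesgue_on \<Omega>. ennreal \<bar>v x\<bar> \<le> Linf_norm \<Omega> v"
    unfolding Linf_norm_def by (rule esssup_AE)
  then have "AE x in lebesgue_on \<Omega>. ennreal \<bar>v x * w x\<bar> \<le> Linf_norm \<Omega> v * ennreal \<bar>w x\<bar>"
    by eventually_elim (simp add: abs_mult ennreal_mult mult_right_mono)
  then have "(\<integral>\<^sup>+x. ennreal \<bar>v x * w x\<bar> \<partial>lebesgue_on \<Omega>)
      \<le> (\<integral>\<^sup>+x. Linf_norm \<Omega> v * ennreal \<bar>w x\<bar> \<partial>lebesgue_on \<Omega>)"
    by (rule nn_integral_mono_AE)
  also have "\<dots> = Linf_norm \<Omega> v * L1_norm \<Omega> w"
    using assms unfolding L1_norm_def by (intro nn_integral_cmult) simp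
  finally show ?thesis .
qed

lemma ip_le_Linf_norm_L1_norm:
  fixes v w :: "real ^ 'n \<Rightarrow> real"
  assumes "w \<in> borel_measurable (lebesgue_on \<Omega>)"
  shows "ennreal \<bar>ip \<Omega> v w\<bar> \<le> Linf_norm \<Omega> v * L1_norm \<Omega> w"
proof (cases "integrable (lebesgue_on \<Omega>) (\<lambda>x. v x * w x)")
  case True
  then have "ennreal \<bar>ip \<Omega> v w\<bar> \<le> (\<integral>\<^sup>+x. ennreal \<bar>v x * w x\<bar> \<partial>lebesgue_on \<Omega>)"
    unfolding ip_def using integral_norm_bound_ennreal[OF True] by simp
  also note nn_integral_abs_mult_le[OF assms]
  finally show ?thesis .
next
  case False
  then show ?thesis by (simp add: ip_def not_integrable_integral_eq)
qed

text \<open>If the right-hand side is finite, then \<open>g * \<phi>\<close> is integrable, so that the pairing is given by \<open>g\<close>.\<close>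

lemma represents_pairing_le:
  assumes g: "represents \<Omega> g F" and \<phi>: "\<phi> \<in> H10 \<Omega>"
  shows "ennreal \<bar>F \<phi>\<bar> \<le> Linf_norm \<Omega> g * L1_norm \<Omega> \<phi>"
    and "ennreal \<bar>F \<phi>\<bar> \<le> L1_norm \<Omega> g * Linf_norm \<Omega> \<phi>"
proof -
  have m: "g \<in> borel_measurable (lebesgue_on \<Omega>)" "\<phi> \<in> borel_measurable (lebesgue_on \<Omega>)"
    using g H10_L2[OF \<phi>] by (auto simp: represents_def L2_def)
  have *: "ennreal \<bar>F \<phi>\<bar> \<le> B"
    if "(\<integral>\<^sup>+x. ennreal \<bar>g x * \<phi> x\<bar> \<partial>lebesgue_on \<Omega>) \<le> B" "ennreal \<bar>ip \<Omega> g \<phi>\<bar> \<le> B" for B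
  proof (cases "B = \<infinity>")
    case False
    then have "(\<integral>\<^sup>+x. ennreal \<bar>g x * \<phi> x\<bar> \<partial>lebesgue_on \<Omega>) < \<infinity>"
      using that(1) by (simp add: less_top[symmetric] top_unique neq_top_trans)
    then have "integrable (lebesgue_on \<Omega>) (\<lambda>x. g x * \<phi> x)"
      using m by (intro integrableI_bounded) auto
    then have "F \<phi> = ip \<Omega> g \<phi>" using g \<phi> by (auto simp: represents_def)
    then show ?thesis using that(2) by simp
  qed simp
  show "ennreal \<bar>F \<phi>\<bar> \<le> Linf_norm \<Omega> g * L1_norm \<Omega> \<phi>"
    by (intro * nn_integral_abs_mult_le ip_le_Linf_norm_L1_norm m)
  show "ennreal \<bar>F \<phi>\<bar> \<le> L1_norm \<Omega> g * Linf_norm \<Omega> \<phi>"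
    using nn_integral_abs_mult_le[OF m(1), of \<phi>] ip_le_Linf_norm_L1_norm[OF m(1), of \<phi>]
    by (intro *) (simp_all add: mult.commute ip_commute)
qed

text \<open>The constant has to be positive: if no function represents \<open>F\<close>, then the bound is trivially
  \<open>c * \<infinity> = \<infinity>\<close>, whereas \<open>c = 0\<close> would claim that \<open>F \<phi> = 0\<close>.\<close>

lemma pairing_le_Linf_fnorm:
  assumes \<phi>: "\<phi> \<in> H10 \<Omega>" and c: "0 < c" "L1_norm \<Omega> \<phi> \<le> ennreal c"
  shows "ennreal \<bar>F \<phi>\<bar> \<le> ennreal c * Linf_fnorm \<Omega> F"
proof -
  have "ennreal \<bar>F \<phi>\<bar> / ennreal c \<le> Linf_norm \<Omega> g" if "represents \<Omega> g F" for g
  proof (rule divide_le_posI_ennreal)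
    have "ennreal \<bar>F \<phi>\<bar> \<le> Linf_norm \<Omega> g * L1_norm \<Omega> \<phi>"
      by (rule represents_pairing_le(1)[OF that \<phi>])
    also have "\<dots> \<le> ennreal c * Linf_norm \<Omega> g"
      using c(2) by (subst mult.commute) (rule mult_right_mono, auto)
    finally show "ennreal \<bar>F \<phi>\<bar> \<le> ennreal c * Linf_norm \<Omega> g" .
  qed (use c in simp)
  then have "ennreal \<bar>F \<phi>\<bar> / ennreal c \<le> Linf_fnorm \<Omega> F"
    unfolding Linf_fnorm_def by (auto intro: INF_greatest)
  then have "ennreal c * (ennreal \<bar>F \<phi>\<bar> / ennreal c) \<le> ennreal c * Linf_fnorm \<Omega> F"
    by (rule mult_left_mono) simp
  then show ?thesis
    using c(1) by (simp add: ennreal_times_divide mult.commute[of "ennreal c" "ennreal \<bar>F \<phi>\<bar>"]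
        mult_divide_eq_ennreal)
qed

lemma represents_unique:
  assumes \<Omega>: "open \<Omega>" and g: "represents \<Omega> g F" and h: "represents \<Omega> h F"
  shows "AE x in lebesgue_on \<Omega>. g x = h x"
proof -
  have "AE x in lebesgue_on \<Omega>. g x - h x = 0"
  proof (rule fundamental_lemma[OF \<Omega>])
    fix \<phi> assume \<phi>: "\<phi> \<in> test_fun \<Omega>"
    have i: "integrable (lebesgue_on \<Omega>) (\<lambda>x. g x * \<phi> x)" "integrable (lebesgue_on \<Omega>) (\<lambda>x. h x * \<phi> x)"
      using g h \<phi> by (auto simp: represents_def)
    then show "integrable (lebesgue_on \<Omega>) (\<lambda>x. (g x - h x) * \<phi> x)"
      by (simp add: left_diff_distrib)
    have "F \<phi> = ip \<Omega> g \<phi>" "F \<phi> = ip \<Omega> h \<phi>"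
      using g h i test_fun_H10[OF \<Omega> \<phi>] by (auto simp: represents_def)
    then have "ip \<Omega> g \<phi> = ip \<Omega> h \<phi>" by simp
    then show "ip \<Omega> (\<lambda>x. g x - h x) \<phi> = 0"
      using i by (simp add: ip_def left_diff_distrib)
  qed
  then show ?thesis by simp
qed

text \<open>The infimum in \<^const>\<open>L1_fnorm\<close> is attained because the representing function is unique. An
  approximating sequence would not be enough when the norm of the functional vanishes while \<open>\<phi>\<close> is
  unbounded.\<close>

lemma pairing_le_L1_fnorm:
  assumes \<Omega>: "open \<Omega>" and \<phi>: "\<phi> \<in> H10 \<Omega>" and F: "L1_fnorm \<Omega> F < \<infinity>"
  shows "ennreal \<bar>F \<phi>\<bar> \<le> L1_fnorm \<Omega> F * Linf_norm \<Omega> \<phi>"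
proof -
  obtain g where g: "represents \<Omega> g F"
    using F unfolding L1_fnorm_def by (auto simp: INF_less_iff)
  have "L1_norm \<Omega> g \<le> L1_norm \<Omega> h" if "represents \<Omega> h F" for h
    unfolding L1_norm_def
    using represents_unique[OF \<Omega> g that] by (intro nn_integral_mono_AE) (auto elim!: eventually_mono)
  then have "L1_norm \<Omega> g \<le> L1_fnorm \<Omega> F"
    unfolding L1_fnorm_def by (auto intro: INF_greatest)
  then have "L1_norm \<Omega> g * Linf_norm \<Omega> \<phi> \<le> L1_fnorm \<Omega> F * Linf_norm \<Omega> \<phi>"
    by (rule mult_right_mono) simp
  with represents_pairing_le(2)[OF g \<phi>] show ?thesis by (rule order_trans)
qed

section \<open>The backward Euler interpolant\<close>

text \<open>\<open>ramp t j\<close> rises linearly from 0 to 1 on the \<open>j\<close>-th mesh interval. The piecewise linear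
  interpolant of \<open>a\<close> is \<open>a 0 + (\<Sum>j. ramp t j * (a j - a (j - 1)))\<close>.\<close>

definition ramp :: "(nat \<Rightarrow> real) \<Rightarrow> nat \<Rightarrow> real \<Rightarrow> real" where
  "ramp t j s = max 0 (min 1 ((s - t (j - 1)) / tstep t j))"

definition dramp :: "(nat \<Rightarrow> real) \<Rightarrow> nat \<Rightarrow> real \<Rightarrow> real" where
  "dramp t j s = (1 / tstep t j) * indicator {t (j - 1)<..t j} s"

lemma mesh_mono:
  assumes "mesh T M t" "i \<le> j" "j \<le> M"
  shows "t i \<le> t j"
  using assms(2,3)
proof (induction j rule: dec_induct)
  case (step k)
  then have "Suc k \<in> {1..M}" by auto
  then have "t (Suc k - 1) < t (Suc k)" using assms(1) unfolding mesh_def by blast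
  then show ?case using step by simp
qed simp

lemma mesh_bounds:
  assumes "mesh T M t" "j \<in> {1..M}"
  shows "0 \<le> t (j - 1)" "t (j - 1) < t j" "t j \<le> T" "0 < tstep t j"
  using mesh_mono[OF assms(1), of 0 "j - 1"] mesh_mono[OF assms(1), of j M] assms
  by (auto simp: mesh_def tstep_def)

lemma mesh_cover:
  assumes "mesh T M t" "0 \<le> s" "s \<le> T" "\<And>j. j \<le> M \<Longrightarrow> s \<noteq> t j"
  obtains k where "k \<in> {1..M}" "t (k - 1) < s" "s < t k"
proof -
  let ?k = "LEAST k. s < t k"
  have "s < t M" using assms(1,3) assms(4)[of M] by (auto simp: mesh_def)
  then have k: "s < t ?k" "?k \<le> M" by (rule LeastI, rule Least_le)
  have "?k \<noteq> 0" using k(1) assms(1,2) by (intro notI) (simp add: mesh_def)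
  then have "\<not> s < t (?k - 1)" by (intro not_less_Least) simp
  moreover have "s \<noteq> t (?k - 1)" using k(2) by (intro assms(4)) simp
  ultimately show thesis using that[of ?k] k \<open>?k \<noteq> 0\<close> by simp
qed

lemma ramp_eq:
  assumes m: "mesh T M t" and k: "k \<in> {1..M}" and j: "j \<in> {1..M}" and s: "t (k - 1) < s" "s < t k"
  shows "ramp t j s = (if j < k then 1 else if j = k then 1 - (t k - s) / tstep t k else 0)"
    and "dramp t j s = (if j = k then 1 / tstep t k else 0)"
proof -
  note b = mesh_bounds[OF m j]
  consider "j < k" | "j = k" | "k < j" by linarith
  then have "ramp t j s = (if j < k then 1 else if j = k then 1 - (t k - s) / tstep t k else 0) \<and>
    dramp t j s = (if j = k then 1 / tstep t k else 0)"
  proof cases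
    case 1
    then have "t j \<le> t (k - 1)" using k by (intro mesh_mono[OF m]) auto
    then have "t j < s" using s by simp
    moreover from this have "1 \<le> (s - t (j - 1)) / tstep t j"
      using b(4) by (simp add: tstep_def field_simps)
    ultimately show ?thesis using 1 by (simp add: ramp_def dramp_def)
  next
    case 2
    have "(s - t (j - 1)) / tstep t j = 1 - (t k - s) / tstep t k"
      using b(4) 2 by (simp add: tstep_def field_simps)
    moreover have "0 \<le> (s - t (j - 1)) / tstep t j" "(s - t (j - 1)) / tstep t j \<le> 1"
      using b s 2 by (auto simp: tstep_def)
    ultimately show ?thesis using 2 s by (simp add: ramp_def dramp_def)
  next
    case 3
    then have "t k \<le> t (j - 1)" using j by (intro mesh_mono[OF m]) auto
    then have "s < t (j - 1)" using s by simp
    moreover from this have "(s - t (j - 1)) / tstep t j \<le> 0"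
      using b(4) by (simp add: divide_nonpos_pos)
    ultimately show ?thesis using 3 by (simp add: ramp_def dramp_def)
  qed
  then show "ramp t j s = (if j < k then 1 else if j = k then 1 - (t k - s) / tstep t k else 0)"
    "dramp t j s = (if j = k then 1 / tstep t k else 0)" by auto
qed

lemma sum_ramp:
  fixes a :: "nat \<Rightarrow> real"
  assumes m: "mesh T M t" and k: "k \<in> {1..M}" and s: "t (k - 1) < s" "s < t k"
  shows "a 0 + (\<Sum>j=1..M. ramp t j s * (a j - a (j - 1))) = a k - (t k - s) * ((a k - a (k - 1)) / tstep t k)"
proof -
  have "(\<Sum>j=1..M. ramp t j s * (a j - a (j - 1)))
      = (\<Sum>j=1..M. (if j \<le> k - 1 then a j - a (j - 1) else 0)
          + (if j = k then (1 - (t k - s) / tstep t k) * (a k - a (k - 1)) else 0))"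
  proof (rule sum.cong[OF refl])
    fix j assume j: "j \<in> {1..M}"
    show "ramp t j s * (a j - a (j - 1)) = (if j \<le> k - 1 then a j - a (j - 1) else 0)
          + (if j = k then (1 - (t k - s) / tstep t k) * (a k - a (k - 1)) else 0)"
      unfolding ramp_eq(1)[OF m k j s] using k by auto
  qed
  also have "\<dots> = (\<Sum>j=1..k - 1. a j - a (j - 1)) + (1 - (t k - s) / tstep t k) * (a k - a (k - 1))"
  proof -
    have "{1..M} \<inter> {j. j \<le> k - 1} = {1..k - 1}" using k by auto
    then show ?thesis using k by (simp add: sum.distrib sum.If_cases sum.delta)
  qed
  also have "(\<Sum>j=1..k - 1. a j - a (j - 1)) = a (k - 1) - a 0"
    using sum_telescope''[of 0 "k - 1" a] by simp
  finally show ?thesis by (simp add: algebra_simps)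
qed

lemma sum_dramp:
  fixes a :: "nat \<Rightarrow> real"
  assumes m: "mesh T M t" and k: "k \<in> {1..M}" and s: "t (k - 1) < s" "s < t k"
  shows "(\<Sum>j=1..M. dramp t j s * (a j - a (j - 1))) = (a k - a (k - 1)) / tstep t k"
proof -
  have "(\<Sum>j=1..M. dramp t j s * (a j - a (j - 1)))
      = (\<Sum>j=1..M. if j = k then (a k - a (k - 1)) / tstep t k else 0)"
    by (rule sum.cong[OF refl]) (simp add: ramp_eq(2)[OF m k _ s])
  then show ?thesis using k by simp
qed

lemma ramp_integral:
  assumes m: "mesh T M t" and j: "j \<in> {1..M}" and r: "0 \<le> r"
  shows "(LINT s:{0..r}|lebesgue. dramp t j s * b) = ramp t j r * b"
proof -
  note b = mesh_bounds[OF m j]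
  have "(LINT s:{0..r}|lebesgue. dramp t j s * b)
      = (\<integral>s. (b / tstep t j) * indicator {t (j - 1)<..min r (t j)} s \<partial>lebesgue)"
    unfolding set_lebesgue_integral_def
    using b by (intro Bochner_Integration.integral_cong) (auto simp: dramp_def indicator_def)
  also have "\<dots> = (b / tstep t j) * measure lebesgue {t (j - 1)<..min r (t j)}"
    by simp
  also have "\<dots> = ramp t j r * b"
    using b by (auto simp: ramp_def tstep_def min_def max_def field_simps)
  finally show ?thesis .
qed

text \<open>The time derivative takes only two values, so it is itself a simple function and serves as its own
  approximating sequence.\<close>

lemma W11_H10_separated:
  fixes v :: "real ^ 'n \<Rightarrow> real"
  assumes \<Omega>: "open \<Omega>" and v: "v \<in> H10 \<Omega>"
    and c: "\<And>r b. 0 \<le> r \<Longrightarrow> c r * b = c 0 * b + (LINT s:{0..r}|lebesgue. (a * indicator {p<..q} s) * b)"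
  shows "W11_H10 T \<Omega> (\<lambda>s x. c s * v x) (\<lambda>s x. (a * indicator {p<..q} s) * v x)"
  unfolding W11_H10_def bochner_H10_def
proof (intro conjI ballI exI[of _ "\<lambda>n s x. (a * indicator {p<..q} s) * v x"] allI AE_I2)
  show "simple_function lebesgue (\<lambda>s x. a * indicator {p<..q::real} s * v x)"
    by (rule simple_function_compose1[of lebesgue "indicator {p<..q}" "\<lambda>r x. a * r * v x"]) simp
  show "range (\<lambda>s x. a * indicator {p<..q} s * v x) \<subseteq> H10 \<Omega>"
    using H10_scale[OF \<Omega> v] by auto
  show "s \<in> {0..T} \<longrightarrow> (\<lambda>n. H1_norm \<Omega> (\<lambda>x. a * indicator {p<..q} s * v x - a * indicator {p<..q} s * v x))
      \<longlonglongrightarrow> 0" for s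
    using H1_norm_zero[OF \<Omega>] by simp
  have "set_integrable lebesgue {0..T} (\<lambda>s. H1_norm \<Omega> (\<lambda>x. a * indicator {p<..q} s * v x))
    \<longleftrightarrow> integrable lebesgue (\<lambda>s. indicator ({0..T} \<inter> {p<..q}) s * H1_norm \<Omega> (\<lambda>x. a * v x))"
    unfolding set_integrable_def
    by (intro Bochner_Integration.integrable_cong refl)
      (auto simp: indicator_def H1_norm_zero[OF \<Omega>])
  also have "\<dots>"
  proof -
    have "emeasure lebesgue ({0..T} \<inter> {p<..q}) \<le> emeasure lebesgue {0..T}"
      by (intro emeasure_mono) auto
    also have "\<dots> < \<infinity>" by (cases "0 \<le> T") auto
    finally show ?thesis
      by (intro integrable_mult_left impI integrable_real_indicator) auto
  qed
  finally show "set_integrable lebesgue {0..T} (\<lambda>s. H1_norm \<Omega> (\<lambda>x. a * indicator {p<..q} s * v x))" .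
  fix r \<phi> assume "r \<in> {0..T}" "\<phi> \<in> H10 \<Omega>"
  then show "ip \<Omega> (\<lambda>x. c r * v x) \<phi>
      = ip \<Omega> (\<lambda>x. c 0 * v x) \<phi> + (LINT s:{0..r}|lebesgue. ip \<Omega> (\<lambda>x. a * indicator {p<..q} s * v x) \<phi>)"
    using c[of r "ip \<Omega> v \<phi>"] by (simp add: ip_def mult.assoc)
qed (use H10_scale[OF \<Omega> v] in auto)

section \<open>Green's function\<close>

lemma greens_functionD:
  assumes "greens_function T \<Omega> L G" "x \<in> \<Omega>"
  shows "0 < r \<Longrightarrow> G x r \<in> H10 \<Omega>"
    and "0 < r \<Longrightarrow> \<phi> \<in> H10 \<Omega> \<Longrightarrow> ((\<lambda>s. ip \<Omega> (G x s) \<phi>) has_real_derivative - L \<phi> (G x r)) (at r)"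
    and "\<phi> \<in> test_fun \<Omega> \<Longrightarrow> ((\<lambda>t. ip \<Omega> (G x t) \<phi>) \<longlongrightarrow> \<phi> x) (at_right 0)"
  using assms unfolding greens_function_def by blast+

text \<open>As \<open>L \<phi> (G x r)\<close> is minus the time derivative of \<open>ip \<Omega> (G x r) \<phi>\<close>, it inherits linearity
  in \<open>\<phi>\<close> from the scalar product.\<close>

lemma operator_lin_comb_at_greens_function:
  fixes v w :: "real ^ 'n \<Rightarrow> real"
  assumes \<Omega>: "open \<Omega>" and G: "greens_function T \<Omega> L G" "x \<in> \<Omega>" and r: "0 < r"
    and vw: "v \<in> H10 \<Omega>" "w \<in> H10 \<Omega>"
  shows "L (\<lambda>y. a * v y + b * w y) (G x r) = a * L v (G x r) + b * L w (G x r)"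
proof -
  note D = greens_functionD(2)[OF G r]
  have "((\<lambda>s. a * ip \<Omega> (G x s) v + b * ip \<Omega> (G x s) w) has_real_derivative
      - (a * L v (G x r) + b * L w (G x r))) (at r)"
    by (auto intro!: derivative_eq_intros D vw)
  moreover have "eventually (\<lambda>s. a * ip \<Omega> (G x s) v + b * ip \<Omega> (G x s) w
      = ip \<Omega> (G x s) (\<lambda>y. a * v y + b * w y)) (nhds r)"
    using eventually_nhds_in_open[of "{0<..}" r] r
    by (auto elim!: eventually_mono simp: ip_commute[of \<Omega> "G x _"]
      ip_lin_comb_left[OF vw[THEN H10_L2] greens_functionD(1)[OF G, THEN H10_L2]])
  ultimately have "((\<lambda>s. ip \<Omega> (G x s) (\<lambda>y. a * v y + b * w y)) has_real_derivative
      - (a * L v (G x r) + b * L w (G x r))) (at r)"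
    by (subst (asm) DERIV_cong_ev[OF refl _ refl])
  from DERIV_unique[OF this D[OF H10_lin_comb[OF \<Omega> vw]]] show ?thesis by simp
qed

lemma greens_representation:
  assumes "greens_function T \<Omega> L G" "0 < T" "W11_H10 T \<Omega> w w'"
  shows "AE x in lebesgue_on \<Omega>. set_integrable lebesgue {0..T} (\<lambda>s. parabolic_op \<Omega> L w w' s (G x (T - s))) \<and>
    w T x = ip \<Omega> (G x T) (w 0) + (LINT s:{0..T}|lebesgue. parabolic_op \<Omega> L w w' s (G x (T - s)))"
  using assms unfolding greens_function_def by auto

lemma dq_eq_lin_comb: "dq t v j = (\<lambda>y. (1 / tstep t j) * v j y + (- 1 / tstep t j) * v (j - 1) y)"
  by (simp add: dq_def diff_divide_distrib)

lemma ip_dq: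
  assumes "v j \<in> L2 \<Omega>" "v (j - 1) \<in> L2 \<Omega>" "\<phi> \<in> L2 \<Omega>"
  shows "ip \<Omega> (dq t v j) \<phi> = (ip \<Omega> (v j) \<phi> - ip \<Omega> (v (j - 1)) \<phi>) / tstep t j"
  unfolding dq_eq_lin_comb ip_lin_comb_left[OF assms] by (simp add: diff_divide_distrib)

text \<open>The piecewise linear interpolant of the \<open>U j\<close> is a combination of functions \<open>ramp t j s * U i x\<close>. The
  representation formula is applied to each of them and to the solution separately, and only the
  resulting scalar identities are combined. In this way \<^const>\<open>W11_H10\<close> need not be shown to be
  closed under sums.\<close>

lemma error_representation:
  fixes u :: "real \<Rightarrow> real ^ 'n \<Rightarrow> real"
  assumes \<Omega>: "open \<Omega>" and T: "0 < T" and G: "greens_function T \<Omega> L G"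
    and u: "parabolic_solution T \<Omega> L f u0 u" and m: "mesh T M t"
    and U: "backward_euler \<Omega> L f u0 M t U"
  shows "AE x in lebesgue_on \<Omega>. \<exists>Q. set_integrable lebesgue {0..T} Q \<and>
    u T x - U M x = (LINT s:{0..T}|lebesgue. Q s) \<and>
    (AE s in lebesgue. \<forall>k\<in>{1..M}. s \<in> {t (k - 1)<..<t k} \<longrightarrow>
       Q s = ip \<Omega> (f s) (G x (T - s)) - ip \<Omega> (f (t k)) (G x (T - s))
         + (t k - s) * dq t (\<lambda>i. L (U i)) k (G x (T - s)))"
proof -
  obtain u' where u': "W11_H10 T \<Omega> u u'"
    and eq: "AE s in lebesgue. s \<in> {0<..T} \<longrightarrow> (\<forall>\<phi>\<in>H10 \<Omega>. parabolic_op \<Omega> L u u' s \<phi> = ip \<Omega> (f s) \<phi>)"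
    and init: "AE x in lebesgue_on \<Omega>. u 0 x = u0 x"
    using u unfolding parabolic_solution_def by blast
  have UH: "U i \<in> H10 \<Omega>" if "i \<le> M" for i
    using U that by (auto simp: backward_euler_def)
  have U0: "AE x in lebesgue_on \<Omega>. u 0 x = U 0 x"
    using init U unfolding backward_euler_def by (auto elim!: eventually_elim2)
  have tM: "t M = T" "t 0 = 0" using m by (auto simp: mesh_def)
  let ?PU = "\<lambda>x s. parabolic_op \<Omega> L (\<lambda>s y. 1 * U 0 y) (\<lambda>s y. (0 * indicator {0<..0::real} s) * U 0 y) s (G x (T - s))"
  let ?P = "\<lambda>j i x s. parabolic_op \<Omega> L (\<lambda>s y. ramp t j s * U i y) (\<lambda>s y. dramp t j s * U i y) s (G x (T - s))"
  let ?Pu = "\<lambda>x s. parabolic_op \<Omega> L u u' s (G x (T - s))"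
  have "W11_H10 T \<Omega> (\<lambda>s y. 1 * U 0 y) (\<lambda>s y. (0 * indicator {0<..0::real} s) * U 0 y)"
    by (rule W11_H10_separated[OF \<Omega> UH]) (auto simp: set_lebesgue_integral_def)
  note rep0 = greens_representation[OF G T this]
  have ramp_0: "ramp t j 0 = 0" and ramp_T: "ramp t j T = 1" if "j \<in> {1..M}" for j
  proof -
    note b = mesh_bounds[OF m that]
    have "(0 - t (j - 1)) / tstep t j \<le> 0" using b by (intro divide_nonpos_pos) auto
    then show "ramp t j 0 = 0" by (simp add: ramp_def)
    have "1 \<le> (T - t (j - 1)) / tstep t j" using b by (simp add: tstep_def)
    then show "ramp t j T = 1" by (simp add: ramp_def)
  qed
  have "AE x in lebesgue_on \<Omega>. set_integrable lebesgue {0..T} (?P j i x) \<and>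
      U i x = (LINT s:{0..T}|lebesgue. ?P j i x s)" if ji: "j \<in> {1..M}" "i \<le> M" for j i
  proof -
    have "W11_H10 T \<Omega> (\<lambda>s y. ramp t j s * U i y) (\<lambda>s y. dramp t j s * U i y)"
      unfolding dramp_def
      by (rule W11_H10_separated[OF \<Omega> UH[OF ji(2)]])
        (simp only: ramp_integral[OF m ji(1), unfolded dramp_def] ramp_0[OF ji(1)] mult_zero_left add_0)
    from greens_representation[OF G T this] show ?thesis
      by eventually_elim (simp add: ramp_0[OF ji(1)] ramp_T[OF ji(1)] ip_def)
  qed
  then have "AE x in lebesgue_on \<Omega>. \<forall>j\<in>{1..M}. \<forall>i\<in>{..M}. set_integrable lebesgue {0..T} (?P j i x) \<and>
      U i x = (LINT s:{0..T}|lebesgue. ?P j i x s)"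
    by (intro AE_ball_countable' countable_finite) auto
  moreover have "AE x in lebesgue_on \<Omega>. x \<in> \<Omega>" by (intro AE_I2) simp
  ultimately show ?thesis
    using rep0 greens_representation[OF G T u']
  proof eventually_elim
    case (elim x)
    let ?g = "\<lambda>s. G x (T - s)"
    define Q where "Q s = ?Pu x s - ?PU x s - (\<Sum>j=1..M. ?P j j x s - ?P j (j - 1) x s)" for s
    have int: "set_integrable lebesgue {0..T} (?P j i x)" "U i x = (LINT s:{0..T}|lebesgue. ?P j i x s)"
      if "j \<in> {1..M}" "i \<le> M" for j i using elim(1) that by auto
    have ind: "indicator {0..T} s *\<^sub>R Q s = indicator {0..T} s *\<^sub>R ?Pu x s - indicator {0..T} s *\<^sub>R ?PU x s
        - (\<Sum>j=1..M. indicator {0..T} s *\<^sub>R ?P j j x s - indicator {0..T} s *\<^sub>R ?P j (j - 1) x s)" for s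
      unfolding Q_def by (simp add: right_diff_distrib sum_distrib_left)
    have ints: "integrable lebesgue (\<lambda>s. indicator {0..T} s *\<^sub>R ?Pu x s)"
      "integrable lebesgue (\<lambda>s. indicator {0..T} s *\<^sub>R ?PU x s)"
      "\<And>j i. j \<in> {1..M} \<Longrightarrow> i \<le> M \<Longrightarrow> integrable lebesgue (\<lambda>s. indicator {0..T} s *\<^sub>R ?P j i x s)"
      using elim(3,4) int(1) unfolding set_integrable_def by blast+
    have 1: "set_integrable lebesgue {0..T} Q"
      unfolding set_integrable_def ind
      by (intro Bochner_Integration.integrable_diff Bochner_Integration.integrable_sum ints) auto
    have "(LINT s:{0..T}|lebesgue. Q s) = (LINT s:{0..T}|lebesgue. ?Pu x s) - (LINT s:{0..T}|lebesgue. ?PU x s)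
        - (\<Sum>j=1..M. (LINT s:{0..T}|lebesgue. ?P j j x s) - (LINT s:{0..T}|lebesgue. ?P j (j - 1) x s))"
      unfolding set_lebesgue_integral_def ind
    proof (subst Bochner_Integration.integral_diff)
      show "integrable lebesgue (\<lambda>s. indicator {0..T} s *\<^sub>R ?Pu x s - indicator {0..T} s *\<^sub>R ?PU x s)"
        by (intro Bochner_Integration.integrable_diff ints)
      show "integrable lebesgue (\<lambda>s. \<Sum>j=1..M. indicator {0..T} s *\<^sub>R ?P j j x s - indicator {0..T} s *\<^sub>R ?P j (j - 1) x s)"
        by (intro Bochner_Integration.integrable_diff Bochner_Integration.integrable_sum ints) auto
      have "(\<integral>s. (\<Sum>j=1..M. indicator {0..T} s *\<^sub>R ?P j j x s - indicator {0..T} s *\<^sub>R ?P j (j - 1) x s) \<partial>lebesgue)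
        = (\<Sum>j=1..M. \<integral>s. indicator {0..T} s *\<^sub>R ?P j j x s - indicator {0..T} s *\<^sub>R ?P j (j - 1) x s \<partial>lebesgue)"
        by (intro Bochner_Integration.integral_sum Bochner_Integration.integrable_diff ints) auto
      also have "\<dots> = (\<Sum>j=1..M. (\<integral>s. indicator {0..T} s *\<^sub>R ?P j j x s \<partial>lebesgue)
          - (\<integral>s. indicator {0..T} s *\<^sub>R ?P j (j - 1) x s \<partial>lebesgue))"
        by (intro sum.cong Bochner_Integration.integral_diff ints refl) auto
      finally show "(\<integral>s. indicator {0..T} s *\<^sub>R ?Pu x s - indicator {0..T} s *\<^sub>R ?PU x s \<partial>lebesgue)
        - (\<integral>s. (\<Sum>j=1..M. indicator {0..T} s *\<^sub>R ?P j j x s - indicator {0..T} s *\<^sub>R ?P j (j - 1) x s) \<partial>lebesgue)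
        = (\<integral>s. indicator {0..T} s *\<^sub>R ?Pu x s \<partial>lebesgue) - (\<integral>s. indicator {0..T} s *\<^sub>R ?PU x s \<partial>lebesgue)
        - (\<Sum>j=1..M. (\<integral>s. indicator {0..T} s *\<^sub>R ?P j j x s \<partial>lebesgue)
          - (\<integral>s. indicator {0..T} s *\<^sub>R ?P j (j - 1) x s \<partial>lebesgue))"
        using Bochner_Integration.integral_diff[OF ints(1,2)] by simp
    qed
    also have "(\<Sum>j=1..M. (LINT s:{0..T}|lebesgue. ?P j j x s) - (LINT s:{0..T}|lebesgue. ?P j (j - 1) x s))
        = (\<Sum>j=1..M. U j x - U (j - 1) x)"
    proof (rule sum.cong[OF refl])
      fix j assume "j \<in> {1..M}"
      then have "j \<in> {1..M}" "j \<le> M" "j - 1 \<le> M" by auto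
      then show "(LINT s:{0..T}|lebesgue. ?P j j x s) - (LINT s:{0..T}|lebesgue. ?P j (j - 1) x s)
          = U j x - U (j - 1) x"
        using int(2)[of j j] int(2)[of j "j - 1"] by simp
    qed
    also have "\<dots> = U M x - U 0 x"
      using sum_telescope''[of 0 M "\<lambda>j. U j x"] by simp
    also have "(LINT s:{0..T}|lebesgue. ?Pu x s) = u T x - ip \<Omega> (G x T) (u 0)"
      using elim(4) by simp
    also have "ip \<Omega> (G x T) (u 0) = ip \<Omega> (G x T) (U 0)"
    proof (rule ip_cong_AE[OF U0])
      show "u 0 \<in> L2 \<Omega>" using u' T by (auto simp: W11_H10_def intro!: H10_L2)
    qed (use UH greens_functionD(1)[OF G \<open>x \<in> \<Omega>\<close>] T in \<open>auto intro: H10_L2\<close>)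
    also have "(LINT s:{0..T}|lebesgue. ?PU x s) = U 0 x - ip \<Omega> (G x T) (U 0)"
      using elim(3) by simp
    finally have 2: "u T x - U M x = (LINT s:{0..T}|lebesgue. Q s)" by simp
    have 3: "AE s in lebesgue. \<forall>k\<in>{1..M}. s \<in> {t (k - 1)<..<t k} \<longrightarrow>
       Q s = ip \<Omega> (f s) (?g s) - ip \<Omega> (f (t k)) (?g s) + (t k - s) * dq t (\<lambda>i. L (U i)) k (?g s)"
      using eq
    proof (eventually_elim, intro ballI impI)
      fix s k
      assume eq: "s \<in> {0<..T} \<longrightarrow> (\<forall>\<phi>\<in>H10 \<Omega>. parabolic_op \<Omega> L u u' s \<phi> = ip \<Omega> (f s) \<phi>)"
        and k: "k \<in> {1..M}" and "s \<in> {t (k - 1)<..<t k}"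
      then have s: "t (k - 1) < s" "s < t k" by auto
      then have sT: "0 < s" "s < T" "0 < T - s" using mesh_bounds[OF m k] by auto
      have g: "?g s \<in> H10 \<Omega>" by (rule greens_functionD(1)[OF G \<open>x \<in> \<Omega>\<close> sT(3)])
      note g2 = H10_L2[OF g]
      have scale: "L (\<lambda>y. a * U i y) (?g s) = a * L (U i) (?g s)" if "i \<le> M" for a i
        using operator_lin_comb_at_greens_function[OF \<Omega> G \<open>x \<in> \<Omega>\<close> sT(3) UH[OF that] UH[OF that], of a 0]
        by simp
      have P: "?P j i x s = dramp t j s * ip \<Omega> (U i) (?g s) + ramp t j s * L (U i) (?g s)" if "i \<le> M" for j i
        using scale[OF that] by (simp add: parabolic_op_def ip_def mult.assoc)
      have P0: "?PU x s = L (U 0) (?g s)" by (simp add: parabolic_op_def ip_def)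
      have Pu: "?Pu x s = ip \<Omega> (f s) (?g s)" using eq sT g by simp
      have "(\<Sum>j=1..M. ?P j j x s - ?P j (j - 1) x s)
          = (\<Sum>j=1..M. dramp t j s * (ip \<Omega> (U j) (?g s) - ip \<Omega> (U (j - 1)) (?g s)))
            + (\<Sum>j=1..M. ramp t j s * (L (U j) (?g s) - L (U (j - 1)) (?g s)))"
        unfolding sum.distrib[symmetric] 
      proof (rule sum.cong[OF refl])
        fix j assume "j \<in> {1..M}"
        then have "j \<le> M" "j - 1 \<le> M" by auto
        then show "?P j j x s - ?P j (j - 1) x s
            = dramp t j s * (ip \<Omega> (U j) (?g s) - ip \<Omega> (U (j - 1)) (?g s))
              + ramp t j s * (L (U j) (?g s) - L (U (j - 1)) (?g s))"
          by (simp only: P) (simp add: algebra_simps)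
      qed
      then have "Q s = ip \<Omega> (f s) (?g s) - (ip \<Omega> (U k) (?g s) - ip \<Omega> (U (k - 1)) (?g s)) / tstep t k
        - (L (U k) (?g s) - (t k - s) * ((L (U k) (?g s) - L (U (k - 1)) (?g s)) / tstep t k))"
        using sum_dramp[OF m k s, of "\<lambda>i. ip \<Omega> (U i) (?g s)"] sum_ramp[OF m k s, of "\<lambda>i. L (U i) (?g s)"]
        unfolding Q_def P0 Pu by linarith
      moreover have "ip \<Omega> (dq t U k) (?g s) + L (U k) (?g s) = ip \<Omega> (f (t k)) (?g s)"
        using U k g by (simp add: backward_euler_def)
      moreover have "ip \<Omega> (dq t U k) (?g s) = (ip \<Omega> (U k) (?g s) - ip \<Omega> (U (k - 1)) (?g s)) / tstep t k"
        using k by (intro ip_dq H10_L2 UH g) auto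
      ultimately show "Q s = ip \<Omega> (f s) (?g s) - ip \<Omega> (f (t k)) (?g s) + (t k - s) * dq t (\<lambda>i. L (U i)) k (?g s)"
        by (simp add: dq_def)
    qed
    from 1 2 3 show ?case by blast
  qed
qed

section \<open>Bounds on the residual\<close>

text \<open>The functions to which this is applied are not known to be measurable in time, so their
  \<^const>\<open>nn_integral\<close> is a lower integral, for which additivity fails in general. Solving the pointwise
  estimate for \<open>F\<close> yields a measurable minorant of \<open>F\<close>.\<close>

lemma nn_integral_le_nonmeasurable:
  fixes c :: real and F :: "'a \<Rightarrow> ennreal"
  assumes [measurable]: "h \<in> borel_measurable M" "b \<in> borel_measurable M"
    and c: "0 < c" and fin: "\<And>s. h s < \<infinity>" and le: "AE s in M. h s \<le> ennreal c * F s + b s"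
  shows "(\<integral>\<^sup>+s. h s \<partial>M) \<le> ennreal c * (\<integral>\<^sup>+s. F s \<partial>M) + (\<integral>\<^sup>+s. b s \<partial>M)"
proof -
  have "AE s in M. (h s - b s) / ennreal c \<le> F s"
    using le
  proof eventually_elim
    case (elim s)
    then have "h s - b s \<le> ennreal c * F s"
      using fin[of s] by (simp add: ennreal_minus_le_iff add.commute less_top[symmetric])
    then show ?case using c by (intro divide_le_posI_ennreal) auto
  qed
  then have le': "(\<integral>\<^sup>+s. (h s - b s) / ennreal c \<partial>M) \<le> (\<integral>\<^sup>+s. F s \<partial>M)"
    by (rule nn_integral_mono_AE)
  have "h s \<le> ennreal c * ((h s - b s) / ennreal c) + b s" for s
  proof -
    have "ennreal c * ((h s - b s) / ennreal c) = h s - b s"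
      using c by (simp add: ennreal_times_divide mult.commute[of "ennreal c"] mult_divide_eq_ennreal)
    then show ?thesis
      using ennreal_minus_le_iff[of "h s" "b s" "h s - b s"] fin[of s] by (simp add: add.commute less_top[symmetric])
  qed
  then have "(\<integral>\<^sup>+s. h s \<partial>M) \<le> (\<integral>\<^sup>+s. ennreal c * ((h s - b s) / ennreal c) + b s \<partial>M)"
    by (intro nn_integral_mono)
  also have "\<dots> = ennreal c * (\<integral>\<^sup>+s. (h s - b s) / ennreal c \<partial>M) + (\<integral>\<^sup>+s. b s \<partial>M)"
    by (simp add: nn_integral_add nn_integral_cmult)
  also have "\<dots> \<le> ennreal c * (\<integral>\<^sup>+s. F s \<partial>M) + (\<integral>\<^sup>+s. b s \<partial>M)"
    using le' by (intro add_right_mono mult_left_mono) auto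
  finally show ?thesis .
qed

text \<open>The weight factors as \<open>(t j - s) / (T - s) = 1 - (T - t j) / (T - s)\<close>, whose primitive is
  logarithmic.\<close>

lemma nn_integral_rho:
  assumes a: "t (j - 1) < t j" and T: "t j \<le> T" and k: "0 \<le> \<kappa>1" "0 \<le> \<kappa>1'"
  shows "(\<integral>\<^sup>+s\<in>{t (j - 1)<..<t j}. ennreal ((t j - s) * (\<kappa>1 / (T - s) + \<kappa>1')) \<partial>lebesgue)
    = ennreal (rho T \<kappa>1 \<kappa>1' t j)"
proof -
  let ?a = "t (j - 1)" and ?b = "t j"
  let ?f = "\<lambda>s. \<kappa>1 * (1 - (T - ?b) / (T - s)) + \<kappa>1' * (?b - s)"
  let ?F = "\<lambda>s. \<kappa>1 * (s + (T - ?b) * ln (T - s)) - \<kappa>1' * (?b - s)\<^sup>2 / 2"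
  have "(\<integral>\<^sup>+s\<in>{?a<..<?b}. ennreal ((?b - s) * (\<kappa>1 / (T - s) + \<kappa>1')) \<partial>lebesgue)
      = (\<integral>\<^sup>+s. ennreal (?f s) * indicator {?a..?b} s \<partial>lebesgue)"
  proof (rule nn_integral_cong_AE)
    have "AE s in lebesgue. s \<noteq> ?a \<and> s \<noteq> ?b"
      by (intro AE_conjI AE_completion AE_lborel_singleton)
    then show "AE s in lebesgue. ennreal ((?b - s) * (\<kappa>1 / (T - s) + \<kappa>1')) * indicator {?a<..<?b} s
        = ennreal (?f s) * indicator {?a..?b} s"
    proof eventually_elim
      case (elim s)
      show ?case
      proof (cases "s \<in> {?a<..<?b}")
        case True
        then have "T - s \<noteq> 0" using T by auto
        then have "(?b - s) * (\<kappa>1 / (T - s) + \<kappa>1') = ?f s" by (simp add: field_simps)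
        then show ?thesis using True by simp
      qed (use elim in auto)
    qed
  qed
  also have "\<dots> = (\<integral>\<^sup>+s. ennreal (?f s) * indicator {?a..?b} s \<partial>lborel)"
    by (rule nn_integral_completion)
  also have "\<dots> = ennreal (?F ?b - ?F ?a)"
  proof (rule nn_integral_FTC_Icc)
    fix s assume "s \<in> {?a..?b}"
    then have s: "?a \<le> s" "s \<le> ?b" by auto
    have 1: "((\<lambda>s. (T - ?b) * ln (T - s)) has_real_derivative - ((T - ?b) / (T - s))) (at s)"
    proof (cases "T = ?b")
      case False
      then have "0 < T - s" using s T by simp
      then have "((\<lambda>s. ln (T - s)) has_real_derivative - (1 / (T - s))) (at s)"
        by (auto intro!: derivative_eq_intros)
      from DERIV_cmult[OF this, of "T - ?b"] show ?thesis by simp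
    qed simp
    have 2: "((\<lambda>s. \<kappa>1' * (?b - s)\<^sup>2 / 2) has_real_derivative - (\<kappa>1' * (?b - s))) (at s)"
      by (auto intro!: derivative_eq_intros simp: field_simps)
    from DERIV_diff[OF DERIV_cmult[OF DERIV_add[OF DERIV_ident 1], of \<kappa>1] 2]
    show "(?F has_real_derivative ?f s) (at s)" by simp
    have "(T - ?b) / (T - s) \<le> 1" using s T by (cases "T = s") auto
    then show "0 \<le> ?f s" using k s by simp
  qed (use a in auto)
  also have "?F ?b - ?F ?a = rho T \<kappa>1 \<kappa>1' t j"
  proof (cases "T = ?b")
    case True
    then show ?thesis by (simp add: rho_def tstep_def algebra_simps)
  next
    case False
    then have p: "0 < T - ?b" "0 < T - ?a" using a T by auto
    have "1 + tstep t j / (T - ?b) = (T - ?a) / (T - ?b)"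
      using p by (simp add: tstep_def field_simps)
    then have "ln (1 + tstep t j / (T - ?b)) = ln (T - ?a) - ln (T - ?b)"
      using p by (simp add: ln_div)
    then have "rho T \<kappa>1 \<kappa>1' t j
        = \<kappa>1 * (tstep t j - (T - ?b) * (ln (T - ?a) - ln (T - ?b))) + \<kappa>1' * (tstep t j)\<^sup>2 / 2"
      by (simp only: rho_def)
    then show ?thesis by (simp add: tstep_def algebra_simps)
  qed
  finally show ?thesis .
qed

text \<open>With \<open>\<kappa>0 = 0\<close> the Green's function would vanish, but it tends to the Dirac distribution.\<close>

lemma greens_bounds_constant_pos:
  fixes x :: "real ^ 'n"
  assumes \<Omega>: "open \<Omega>" and T: "0 < T" and G: "greens_function T \<Omega> L G" and x: "x \<in> \<Omega>"
    and bd: "greens_bounds T \<Omega> G \<kappa>0 \<kappa>1 \<kappa>1' \<gamma>"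
  shows "0 < \<kappa>0"
proof (rule ccontr)
  assume "\<not> 0 < \<kappa>0"
  then have neg: "\<kappa>0 * exp (- \<gamma> * r) \<le> 0" for r by (simp add: mult_nonpos_nonneg)
  obtain a b where ab: "cbox a b \<subseteq> \<Omega>" "x \<in> box a b"
    using open_contains_cbox[OF \<Omega> x] by metis
  let ?\<phi> = "bump a b 1"
  have \<phi>: "?\<phi> \<in> test_fun \<Omega>" using ab(1) by (intro bump_test_fun) auto
  have "ip \<Omega> (G x r) ?\<phi> = 0" if r: "r \<in> {0<..<T}" for r
  proof -
    have "L1_norm \<Omega> (G x r) \<le> ennreal (\<kappa>0 * exp (- \<gamma> * r))"
      using bd x r by (auto simp: greens_bounds_def)
    then have L1: "L1_norm \<Omega> (G x r) = 0" using neg[of r] by (simp add: ennreal_neg)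
    have "G x r \<in> L2 \<Omega>" using r by (intro H10_L2 greens_functionD(1)[OF G x]) simp
    from ip_le_Linf_norm_L1_norm[OF L2_measurable[OF this], of ?\<phi>] L1 show ?thesis
      by (simp add: ip_commute)
  qed
  moreover have "eventually (\<lambda>r. r \<in> {0<..<T}) (at_right 0)"
    using T by (rule eventually_at_right_real)
  ultimately have "eventually (\<lambda>r. 0 = ip \<Omega> (G x r) ?\<phi>) (at_right 0)"
    by (auto elim!: eventually_mono)
  then have "((\<lambda>r. ip \<Omega> (G x r) ?\<phi>) \<longlongrightarrow> 0) (at_right 0)"
    by (rule Lim_transform_eventually[OF tendsto_const])
  with greens_functionD(3)[OF G x \<phi>] have "?\<phi> x = 0"
    by (rule tendsto_unique[OF trivial_limit_at_right_real])
  then show False using bump_pos_iff[of 1 a b x] ab(2) by simp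
qed

text \<open>The three estimates differ in how the operator is removed from the residual: its difference quotient
  is measured in the maximum norm, or moved onto the Green's function as a time derivative, or
  eliminated by means of the backward Euler equation.\<close>

lemma residual_integral_le:
  fixes x :: "real ^ 'n" and f :: "real \<Rightarrow> real ^ 'n \<Rightarrow> real"
  assumes \<Omega>: "open \<Omega>" and T: "0 < T" and f: "\<forall>s\<in>{0..T}. f s \<in> L2 \<Omega>"
    and \<kappa>: "0 \<le> \<kappa>1" "0 \<le> \<kappa>1'" "0 \<le> \<gamma>"
    and G: "greens_function T \<Omega> L G" and bd: "greens_bounds T \<Omega> G \<kappa>0 \<kappa>1 \<kappa>1' \<gamma>"
    and m: "mesh T M t" and U: "backward_euler \<Omega> L f u0 M t U"
    and x: "x \<in> \<Omega>" and k: "k \<in> {1..M}" and Q: "set_integrable lebesgue {0..T} Q"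
    and Q_eq: "AE s in lebesgue. s \<in> {t (k - 1)<..<t k} \<longrightarrow>
       Q s = ip \<Omega> (f s) (G x (T - s)) - ip \<Omega> (f (t k)) (G x (T - s))
         + (t k - s) * dq t (\<lambda>i. L (U i)) k (G x (T - s))"
  shows "(\<integral>\<^sup>+s\<in>{t (k - 1)<..<t k}. ennreal \<bar>Q s\<bar> \<partial>lebesgue) \<le> ennreal (exp (- \<gamma> * (T - t k))) *
       min (eta_fbar \<Omega> \<kappa>0 t f k + min (eta_dU T \<Omega> \<kappa>1 \<kappa>1' t U k) (eta_dLU \<Omega> L \<kappa>0 t U k))
           (eta_fhat \<Omega> \<kappa>0 t f k + eta_d2U \<Omega> L \<kappa>0 t f U k)"
proof -
  let ?I = "{t (k - 1)<..<t k}" and ?g = "\<lambda>s. G x (T - s)"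
  let ?D = "dq t (\<lambda>i. L (U i)) k"
  define E where "E = exp (- \<gamma> * (T - t k))"
  note b = mesh_bounds[OF m k]
  have E: "0 < E" by (simp add: E_def)
  have \<kappa>0: "0 < \<kappa>0" by (rule greens_bounds_constant_pos[OF \<Omega> T G x bd])
  have UH: "U k \<in> H10 \<Omega>" "U (k - 1) \<in> H10 \<Omega>" using U k by (auto simp: backward_euler_def)
  have fL: "f (t k) \<in> L2 \<Omega>" "f (t (k - 1)) \<in> L2 \<Omega>" using f b by auto
  have I: "0 < s" "s < T" "0 < T - s" "T - s \<in> {0<..T}" "exp (- \<gamma> * (T - s)) \<le> E" "0 < t k - s"
      "f s \<in> L2 \<Omega>" "?g s \<in> H10 \<Omega>" "?g s \<in> L2 \<Omega>" "?g s \<in> borel_measurable (lebesgue_on \<Omega>)"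
    if s: "s \<in> ?I" for s
  proof -
    show 1: "0 < s" "s < T" "0 < T - s" "T - s \<in> {0<..T}" "0 < t k - s" using s b by auto
    show "exp (- \<gamma> * (T - s)) \<le> E" using s \<kappa>(3) by (auto simp: E_def intro!: mult_left_mono)
    show "f s \<in> L2 \<Omega>" using f 1 by simp
    show "?g s \<in> H10 \<Omega>" by (rule greens_functionD(1)[OF G x 1(3)])
    then show "?g s \<in> L2 \<Omega>" by (rule H10_L2)
    then show "?g s \<in> borel_measurable (lebesgue_on \<Omega>)" by (rule L2_measurable)
  qed
  have L1: "L1_norm \<Omega> (?g s) \<le> ennreal (\<kappa>0 * E)" if s: "s \<in> ?I" for s
  proof -
    have "L1_norm \<Omega> (?g s) \<le> ennreal (\<kappa>0 * exp (- \<gamma> * (T - s)))"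
      using bd x I(4)[OF s] by (auto simp: greens_bounds_def)
    also have "\<dots> \<le> ennreal (\<kappa>0 * E)"
      using I(5)[OF s] \<kappa>0 by (intro ennreal_leI mult_left_mono) auto
    finally show ?thesis .
  qed
  have fbound: "ennreal \<bar>ip \<Omega> v (?g s)\<bar> \<le> ennreal (\<kappa>0 * E) * Linf_norm \<Omega> v" if s: "s \<in> ?I" for s v
  proof -
    have "ennreal \<bar>ip \<Omega> v (?g s)\<bar> \<le> Linf_norm \<Omega> v * L1_norm \<Omega> (?g s)"
      by (rule ip_le_Linf_norm_L1_norm[OF I(10)[OF s]])
    also have "\<dots> \<le> Linf_norm \<Omega> v * ennreal (\<kappa>0 * E)"
      by (intro mult_left_mono L1 s) simp
    finally show ?thesis by (simp add: mult.commute)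
  qed
  \<comment> \<open>The factor \<open>0 / (T - s) + \<kappa>0\<close> is the weight of \<open>nn_integral_rho\<close> for the constants 0 and \<open>\<kappa>0\<close>.\<close>
  have Dbound: "ennreal \<bar>D (?g s)\<bar> \<le> ennreal (0 / (T - s) + \<kappa>0) * (ennreal E * Linf_fnorm \<Omega> D)"
    if s: "s \<in> ?I" for s D
    using pairing_le_Linf_fnorm[OF I(8)[OF s] _ L1[OF s], of D] \<kappa>0 E
    by (simp add: ennreal_mult mult.assoc)
  have dUbound: "ennreal \<bar>?D (?g s)\<bar> \<le> ennreal (\<kappa>1 / (T - s) + \<kappa>1') * (ennreal E * Linf_norm \<Omega> (dq t U k))"
    if s: "s \<in> ?I" for s
  proof -
    let ?r = "T - s" and ?dU = "dq t U k"
    let ?F = "\<lambda>\<phi>. deriv (\<lambda>s. ip \<Omega> (G x s) \<phi>) ?r"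
    have dU: "?dU \<in> H10 \<Omega>" unfolding dq_eq_lin_comb by (intro H10_lin_comb \<Omega> UH)
    \<comment> \<open>This moves the operator onto the Green's function: \<open>\<langle>L w, G\<rangle> = - d/dt \<langle>G, w\<rangle>\<close>.\<close>
    have "?F ?dU = - L ?dU (?g s)"
      by (intro DERIV_imp_deriv greens_functionD(2)[OF G x I(3)[OF s]] dU)
    also have "L ?dU (?g s) = ?D (?g s)"
      unfolding dq_eq_lin_comb operator_lin_comb_at_greens_function[OF \<Omega> G x I(3)[OF s] UH] ..
    finally have F: "\<bar>?F ?dU\<bar> = \<bar>?D (?g s)\<bar>" by simp
    have nn: "0 \<le> \<kappa>1 / ?r + \<kappa>1'" using \<kappa> I(3)[OF s] by simp
    have "L1_fnorm \<Omega> ?F \<le> ennreal ((\<kappa>1 / ?r + \<kappa>1') * exp (- \<gamma> * ?r))"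
      using bd x I(4)[OF s] by (auto simp: greens_bounds_def)
    also have "\<dots> \<le> ennreal ((\<kappa>1 / ?r + \<kappa>1') * E)"
      using I(5)[OF s] nn by (intro ennreal_leI mult_left_mono)
    finally have L: "L1_fnorm \<Omega> ?F \<le> ennreal ((\<kappa>1 / ?r + \<kappa>1') * E)" .
    then have "L1_fnorm \<Omega> ?F < \<infinity>" by (rule le_less_trans) simp
    from pairing_le_L1_fnorm[OF \<Omega> dU this]
    have "ennreal \<bar>?D (?g s)\<bar> \<le> L1_fnorm \<Omega> ?F * Linf_norm \<Omega> ?dU" unfolding F .
    also have "\<dots> \<le> ennreal ((\<kappa>1 / ?r + \<kappa>1') * E) * Linf_norm \<Omega> ?dU"
      by (intro mult_right_mono L) simp
    finally show ?thesis using nn E by (simp add: ennreal_mult mult.assoc)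
  qed
  have main: "(\<integral>\<^sup>+s\<in>?I. ennreal \<bar>Q s\<bar> \<partial>lebesgue)
      \<le> ennreal E * (ennreal \<kappa>0 * (\<integral>\<^sup>+s\<in>?I. Linf_norm \<Omega> (v s) \<partial>lebesgue) + ennreal (rho T \<alpha> \<beta> t k) * N)"
    if \<alpha>\<beta>: "0 \<le> \<alpha>" "0 \<le> \<beta>"
      and split: "AE s in lebesgue. s \<in> ?I \<longrightarrow> \<bar>Q s\<bar> \<le> \<bar>ip \<Omega> (v s) (?g s)\<bar> + (t k - s) * \<bar>D (?g s)\<bar>"
      and D: "\<And>s. s \<in> ?I \<Longrightarrow> ennreal \<bar>D (?g s)\<bar> \<le> ennreal (\<alpha> / (T - s) + \<beta>) * (ennreal E * N)"
    for v D \<alpha> \<beta> N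
  proof -
    let ?w = "\<lambda>s. ennreal ((t k - s) * (\<alpha> / (T - s) + \<beta>))"
    have wm[measurable]: "?w \<in> borel_measurable lebesgue"
      by (intro measurable_completion) simp
    have [measurable]: "?I \<in> sets lebesgue" by simp
    have [measurable]: "(\<lambda>s. indicator {0..T} s *\<^sub>R Q s) \<in> borel_measurable lebesgue"
      by (rule borel_measurable_integrable[OF Q[unfolded set_integrable_def]])
    have "(\<lambda>s. ennreal \<bar>indicator {0..T} s *\<^sub>R Q s\<bar> * indicator ?I s) \<in> borel_measurable lebesgue"
      by measurable
    also have "(\<lambda>s. ennreal \<bar>indicator {0..T} s *\<^sub>R Q s\<bar> * indicator ?I s) = (\<lambda>s. ennreal \<bar>Q s\<bar> * indicator ?I s)"
      using b by (intro ext) (auto simp: indicator_def)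
    finally have Qm: "(\<lambda>s. ennreal \<bar>Q s\<bar> * indicator ?I s) \<in> borel_measurable lebesgue" .
    have wim: "(\<lambda>s. ?w s * indicator ?I s) \<in> borel_measurable lebesgue"
      by measurable
    have "(\<integral>\<^sup>+s\<in>?I. ennreal \<bar>Q s\<bar> \<partial>lebesgue)
        \<le> ennreal (\<kappa>0 * E) * (\<integral>\<^sup>+s\<in>?I. Linf_norm \<Omega> (v s) \<partial>lebesgue)
          + (\<integral>\<^sup>+s. ?w s * indicator ?I s * (ennreal E * N) \<partial>lebesgue)"
    proof (rule nn_integral_le_nonmeasurable[OF Qm])
      show "(\<lambda>s. ?w s * indicator ?I s * (ennreal E * N)) \<in> borel_measurable lebesgue"
        using wim by measurable
      show "0 < \<kappa>0 * E" using \<kappa>0 E by simp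
      show "ennreal \<bar>Q s\<bar> * indicator ?I s < \<infinity>" for s by (simp add: indicator_def)
      show "AE s in lebesgue. ennreal \<bar>Q s\<bar> * indicator ?I s
          \<le> ennreal (\<kappa>0 * E) * (Linf_norm \<Omega> (v s) * indicator ?I s) + ?w s * indicator ?I s * (ennreal E * N)"
        using split
      proof eventually_elim
        case (elim s)
        show ?case
        proof (cases "s \<in> ?I")
          case True
          note pos = I(3)[OF True] I(6)[OF True]
          have "ennreal \<bar>Q s\<bar> \<le> ennreal (\<bar>ip \<Omega> (v s) (?g s)\<bar> + (t k - s) * \<bar>D (?g s)\<bar>)"
            using elim True by (intro ennreal_leI) simp
          also have "\<dots> = ennreal \<bar>ip \<Omega> (v s) (?g s)\<bar> + ennreal (t k - s) * ennreal \<bar>D (?g s)\<bar>"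
            using pos by (simp add: ennreal_mult)
          also have "\<dots> \<le> ennreal (\<kappa>0 * E) * Linf_norm \<Omega> (v s)
              + ennreal (t k - s) * (ennreal (\<alpha> / (T - s) + \<beta>) * (ennreal E * N))"
            by (intro add_mono mult_left_mono fbound D True) simp
          also have "ennreal (t k - s) * (ennreal (\<alpha> / (T - s) + \<beta>) * (ennreal E * N)) = ?w s * (ennreal E * N)"
            using pos \<alpha>\<beta> by (simp add: ennreal_mult mult.assoc)
          finally show ?thesis using True by simp
        qed simp
      qed
    qed
    also have "(\<integral>\<^sup>+s. ?w s * indicator ?I s * (ennreal E * N) \<partial>lebesgue) = ennreal (rho T \<alpha> \<beta> t k) * (ennreal E * N)"
      using nn_integral_rho[of t k T \<alpha> \<beta>] b \<alpha>\<beta> by (subst nn_integral_multc[OF wim]) simp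
    finally show ?thesis using \<kappa>0 E by (simp add: ennreal_mult distrib_left mult_ac)
  qed
  have ip_diff: "ip \<Omega> (\<lambda>y. v y - w y) \<phi> = ip \<Omega> v \<phi> - ip \<Omega> w \<phi>"
    if "v \<in> L2 \<Omega>" "w \<in> L2 \<Omega>" "\<phi> \<in> L2 \<Omega>" for v w \<phi>
    using ip_lin_comb_left[OF that, of 1 "-1"] by simp
  have split: "AE s in lebesgue. s \<in> ?I \<longrightarrow>
      \<bar>Q s\<bar> \<le> \<bar>ip \<Omega> (\<lambda>y. f s y - f (t k) y) (?g s)\<bar> + (t k - s) * \<bar>?D (?g s)\<bar>"
    using Q_eq
  proof (eventually_elim, intro impI)
    fix s
    assume s: "s \<in> ?I" and "s \<in> ?I \<longrightarrow> Q s = ip \<Omega> (f s) (?g s) - ip \<Omega> (f (t k)) (?g s) + (t k - s) * ?D (?g s)"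
    then have "Q s = ip \<Omega> (\<lambda>y. f s y - f (t k) y) (?g s) + (t k - s) * ?D (?g s)"
      using ip_diff[OF I(7)[OF s] fL(1) I(9)[OF s]] by simp
    then show "\<bar>Q s\<bar> \<le> \<bar>ip \<Omega> (\<lambda>y. f s y - f (t k) y) (?g s)\<bar> + (t k - s) * \<bar>?D (?g s)\<bar>"
      using I(6)[OF s] abs_triangle_ineq[of "ip \<Omega> (\<lambda>y. f s y - f (t k) y) (?g s)" "(t k - s) * ?D (?g s)"]
      by (simp add: abs_mult)
  qed
  let ?DD = "dq t (dtU \<Omega> L f t U) k"
  have split2: "AE s in lebesgue. s \<in> ?I \<longrightarrow>
      \<bar>Q s\<bar> \<le> \<bar>ip \<Omega> (\<lambda>y. f s y - fhat t f k s y) (?g s)\<bar> + (t k - s) * \<bar>?DD (?g s)\<bar>"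
    using Q_eq
  proof (eventually_elim, intro impI)
    fix s
    assume s: "s \<in> ?I" and Qs: "s \<in> ?I \<longrightarrow> Q s = ip \<Omega> (f s) (?g s) - ip \<Omega> (f (t k)) (?g s) + (t k - s) * ?D (?g s)"
    note L2 = fL I(7,9)[OF s]
    let ?df = "dq t (\<lambda>i. f (t i)) k"
    have dfL: "?df \<in> L2 \<Omega>"
      unfolding dq_eq_lin_comb using L2_lin_comb[OF fL, of "1 / tstep t k" "- 1 / tstep t k"] by simp
    have hat: "fhat t f k s = (\<lambda>y. 1 * f (t k) y + (- (t k - s)) * ?df y)"
      by (simp add: fhat_def left_diff_distrib algebra_simps)
    have "fhat t f k s \<in> L2 \<Omega>"
      unfolding hat using L2_lin_comb[OF fL(1) dfL, of 1 "- (t k - s)"] by simp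
    then have "ip \<Omega> (\<lambda>y. f s y - fhat t f k s y) (?g s) = ip \<Omega> (f s) (?g s) - ip \<Omega> (fhat t f k s) (?g s)"
      by (intro ip_diff L2)
    moreover have "ip \<Omega> (fhat t f k s) (?g s) = 1 * ip \<Omega> (f (t k)) (?g s) + (- (t k - s)) * ip \<Omega> ?df (?g s)"
      unfolding hat by (rule ip_lin_comb_left[OF fL(1) dfL L2(4)])
    ultimately have 1: "ip \<Omega> (\<lambda>y. f s y - fhat t f k s y) (?g s)
        = ip \<Omega> (f s) (?g s) - (ip \<Omega> (f (t k)) (?g s) - (t k - s) * ip \<Omega> ?df (?g s))"
      by (simp add: left_diff_distrib)
    have dt: "dtU \<Omega> L f t U j (?g s) = ip \<Omega> (f (t j)) (?g s) - L (U j) (?g s)" if "j \<le> M" for j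
      using U I(8)[OF s] that by (auto simp: dtU_def backward_euler_def algebra_simps)
    have kM: "k \<le> M" "k - 1 \<le> M" using k by auto
    \<comment> \<open>The discrete equation trades the difference quotient of \<open>L U\<close> for that of \<open>f - \<delta>\<^sub>t U\<close>.\<close>
    have df: "ip \<Omega> ?df (?g s) = ?DD (?g s) + ?D (?g s)"
      using dt[OF kM(1)] dt[OF kM(2)] ip_dq[of "\<lambda>i. f (t i)" k \<Omega> "?g s", OF L2(1,2,4)]
      by (simp add: dq_def[of t "dtU \<Omega> L f t U"] dq_def[of t "\<lambda>i. L (U i)"] diff_divide_distrib)
    then have "Q s = ip \<Omega> (\<lambda>y. f s y - fhat t f k s y) (?g s) - (t k - s) * ?DD (?g s)"
      using Qs s unfolding 1 df by (simp add: algebra_simps)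
    then show "\<bar>Q s\<bar> \<le> \<bar>ip \<Omega> (\<lambda>y. f s y - fhat t f k s y) (?g s)\<bar> + (t k - s) * \<bar>?DD (?g s)\<bar>"
      using I(6)[OF s] abs_triangle_ineq4[of "ip \<Omega> (\<lambda>y. f s y - fhat t f k s y) (?g s)" "(t k - s) * ?DD (?g s)"]
      by (simp add: abs_mult)
  qed
  have rho0: "rho T 0 \<kappa>0 t k = \<kappa>0 * (tstep t k)\<^sup>2 / 2" by (simp add: rho_def)
  have "(\<integral>\<^sup>+s\<in>?I. ennreal \<bar>Q s\<bar> \<partial>lebesgue) \<le> ennreal E * (eta_fbar \<Omega> \<kappa>0 t f k + eta_dLU \<Omega> L \<kappa>0 t U k)"
    using main[where \<alpha> = 0 and \<beta> = \<kappa>0, OF _ _ split Dbound] \<kappa>0 unfolding rho0 eta_fbar_def eta_dLU_def by simp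
  moreover have "(\<integral>\<^sup>+s\<in>?I. ennreal \<bar>Q s\<bar> \<partial>lebesgue) \<le> ennreal E * (eta_fbar \<Omega> \<kappa>0 t f k + eta_dU T \<Omega> \<kappa>1 \<kappa>1' t U k)"
    using main[OF \<kappa>(1,2) split dUbound] unfolding eta_fbar_def eta_dU_def .
  moreover have "(\<integral>\<^sup>+s\<in>?I. ennreal \<bar>Q s\<bar> \<partial>lebesgue) \<le> ennreal E * (eta_fhat \<Omega> \<kappa>0 t f k + eta_d2U \<Omega> L \<kappa>0 t f U k)"
    using main[where \<alpha> = 0 and \<beta> = \<kappa>0, OF _ _ split2 Dbound] \<kappa>0 unfolding rho0 eta_fhat_def eta_d2U_def by simp
  ultimately show ?thesis
    unfolding E_def[symmetric] min_def by auto
qed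

text \<open>The open mesh intervals cover \<open>{0..T}\<close> up to finitely many points.\<close>

lemma set_integral_le_sum_mesh:
  assumes m: "mesh T M t" and Q: "set_integrable lebesgue {0..T} Q"
  shows "ennreal \<bar>LINT s:{0..T}|lebesgue. Q s\<bar>
    \<le> (\<Sum>k=1..M. \<integral>\<^sup>+s\<in>{t (k - 1)<..<t k}. ennreal \<bar>Q s\<bar> \<partial>lebesgue)"
proof -
  let ?h = "\<lambda>s. ennreal \<bar>indicator {0..T} s *\<^sub>R Q s\<bar>"
  have h: "?h \<in> borel_measurable lebesgue"
    using borel_measurable_integrable[OF Q[unfolded set_integrable_def]]
    by (intro measurable_compose[OF _ measurable_ennreal] borel_measurable_abs)
  have "ennreal \<bar>LINT s:{0..T}|lebesgue. Q s\<bar> \<le> (\<integral>\<^sup>+s. ?h s \<partial>lebesgue)"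
    using integral_norm_bound_ennreal[OF Q[unfolded set_integrable_def]]
    by (simp add: set_lebesgue_integral_def)
  also have "\<dots> \<le> (\<integral>\<^sup>+s. (\<Sum>k=1..M. ?h s * indicator {t (k - 1)<..<t k} s) \<partial>lebesgue)"
  proof (rule nn_integral_mono_AE)
    have "AE s in lebesgue. \<forall>j\<in>{..M}. s \<noteq> t j"
      by (intro AE_ball_countable' AE_completion AE_lborel_singleton countable_finite) simp
    then show "AE s in lebesgue. ?h s \<le> (\<Sum>k=1..M. ?h s * indicator {t (k - 1)<..<t k} s)"
    proof eventually_elim
      case (elim s)
      show ?case
      proof (cases "s \<in> {0..T}")
        case True
        then obtain k where k: "k \<in> {1..M}" "t (k - 1) < s" "s < t k"
          using mesh_cover[OF m, of s] elim by auto
        then have "?h s = ?h s * indicator {t (k - 1)<..<t k} s" by simp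
        also have "\<dots> \<le> (\<Sum>k=1..M. ?h s * indicator {t (k - 1)<..<t k} s)"
          by (rule member_le_sum[OF k(1)]) auto
        finally show ?thesis .
      qed simp
    qed
  qed
  also have "\<dots> = (\<Sum>k=1..M. \<integral>\<^sup>+s. ?h s * indicator {t (k - 1)<..<t k} s \<partial>lebesgue)"
    by (intro nn_integral_sum borel_measurable_times_ennreal h borel_measurable_indicator) simp
  also have "\<dots> = (\<Sum>k=1..M. \<integral>\<^sup>+s\<in>{t (k - 1)<..<t k}. ennreal \<bar>Q s\<bar> \<partial>lebesgue)"
  proof (intro sum.cong nn_integral_cong refl)
    fix k s assume "k \<in> {1..M}"
    then show "?h s * indicator {t (k - 1)<..<t k} s = ennreal \<bar>Q s\<bar> * indicator {t (k - 1)<..<t k} s"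
      using mesh_bounds[OF m, of k] by (auto simp: indicator_def)
  qed
  finally show ?thesis .
qed

theorem theorem5:
  fixes \<Omega> :: "(real ^ 'n) set"
    and L :: "(real ^ 'n \<Rightarrow> real) \<Rightarrow> (real ^ 'n \<Rightarrow> real) \<Rightarrow> real"
    and G :: "real ^ 'n \<Rightarrow> real \<Rightarrow> real ^ 'n \<Rightarrow> real"
    and f u :: "real \<Rightarrow> real ^ 'n \<Rightarrow> real"
    and u0 :: "real ^ 'n \<Rightarrow> real"
    and U :: "nat \<Rightarrow> real ^ 'n \<Rightarrow> real"
    and t :: "nat \<Rightarrow> real"
    and M :: nat
    and T \<kappa>0 \<kappa>1 \<kappa>1' \<gamma> :: real
  assumes "lipschitz_domain \<Omega>" and "0 < T"
    and "elliptic_operator \<Omega> L"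
    and "\<forall>s\<in>{0..T}. f s \<in> L2 \<Omega>"
    and "0 \<le> \<kappa>0" and "0 \<le> \<kappa>1" and "0 \<le> \<kappa>1'" and "0 \<le> \<gamma>"
    and "greens_function T \<Omega> L G"
    and "greens_bounds T \<Omega> G \<kappa>0 \<kappa>1 \<kappa>1' \<gamma>"
    and "parabolic_solution T \<Omega> L f u0 u"
    and "mesh T M t"
    and "backward_euler \<Omega> L f u0 M t U"
  shows "Linf_norm \<Omega> (\<lambda>x. u T x - U M x) \<le>
    (\<Sum>j=1..M. ennreal (exp (- \<gamma> * (T - t j))) *
       min (eta_fbar \<Omega> \<kappa>0 t f j + min (eta_dU T \<Omega> \<kappa>1 \<kappa>1' t U j) (eta_dLU \<Omega> L \<kappa>0 t U j))
           (eta_fhat \<Omega> \<kappa>0 t f j + eta_d2U \<Omega> L \<kappa>0 t f U j))"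
  (is "_ \<le> ?B")
proof -
  have \<Omega>: "open \<Omega>" using \<open>lipschitz_domain \<Omega>\<close> by (simp add: lipschitz_domain_def)
  have "u T \<in> H10 \<Omega>"
    using \<open>parabolic_solution T \<Omega> L f u0 u\<close> \<open>0 < T\<close> by (auto simp: parabolic_solution_def W11_H10_def)
  moreover have "U M \<in> H10 \<Omega>"
    using \<open>backward_euler \<Omega> L f u0 M t U\<close> by (simp add: backward_euler_def)
  ultimately have meas: "(\<lambda>x. ennreal \<bar>u T x - U M x\<bar>) \<in> borel_measurable (lebesgue_on \<Omega>)"
    by (intro measurable_compose[OF _ measurable_ennreal] borel_measurable_abs borel_measurable_diff
        L2_measurable H10_L2)
  have "AE x in lebesgue_on \<Omega>. x \<in> \<Omega>" by (intro AE_I2) simp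
  with error_representation[OF \<Omega> \<open>0 < T\<close> assms(9,11,12,13)]
  have "AE x in lebesgue_on \<Omega>. ennreal \<bar>u T x - U M x\<bar> \<le> ?B"
  proof eventually_elim
    case (elim x)
    then obtain Q where Q: "set_integrable lebesgue {0..T} Q"
      "u T x - U M x = (LINT s:{0..T}|lebesgue. Q s)"
      and eq: "AE s in lebesgue. \<forall>k\<in>{1..M}. s \<in> {t (k - 1)<..<t k} \<longrightarrow>
       Q s = ip \<Omega> (f s) (G x (T - s)) - ip \<Omega> (f (t k)) (G x (T - s))
         + (t k - s) * dq t (\<lambda>i. L (U i)) k (G x (T - s))"
      by blast
    have "ennreal \<bar>u T x - U M x\<bar>
        \<le> (\<Sum>k=1..M. \<integral>\<^sup>+s\<in>{t (k - 1)<..<t k}. ennreal \<bar>Q s\<bar> \<partial>lebesgue)"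
      unfolding Q(2) by (rule set_integral_le_sum_mesh[OF assms(12) Q(1)])
    also have "\<dots> \<le> ?B"
    proof (rule sum_mono)
      fix k assume k: "k \<in> {1..M}"
      from eq have "AE s in lebesgue. s \<in> {t (k - 1)<..<t k} \<longrightarrow>
         Q s = ip \<Omega> (f s) (G x (T - s)) - ip \<Omega> (f (t k)) (G x (T - s))
           + (t k - s) * dq t (\<lambda>i. L (U i)) k (G x (T - s))"
        using k by (auto elim!: eventually_mono)
      from residual_integral_le[OF \<Omega> assms(2,4,6,7,8,9,10,12,13) \<open>x \<in> \<Omega>\<close> k Q(1) this]
      show "(\<integral>\<^sup>+s\<in>{t (k - 1)<..<t k}. ennreal \<bar>Q s\<bar> \<partial>lebesgue) \<le> ennreal (exp (- \<gamma> * (T - t k))) *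
         min (eta_fbar \<Omega> \<kappa>0 t f k + min (eta_dU T \<Omega> \<kappa>1 \<kappa>1' t U k) (eta_dLU \<Omega> L \<kappa>0 t U k))
             (eta_fhat \<Omega> \<kappa>0 t f k + eta_d2U \<Omega> L \<kappa>0 t f U k)" .
    qed
    finally show ?case .
  qed
  then show ?thesis unfolding Linf_norm_def by (rule esssup_I[OF meas])
qed

end
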